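(* Let $\mathcal H_{\mathrm{in}}$ be a finite-dimensional complex Hilbert space and $\mathcal M\subseteq\mathcal D(\mathcal H_{\mathrm{in}})$ a set of density operators. There exists a finite-dimensional Hilbert space $\mathcal H_{\mathrm{out}}$ and a CPTP map $\Lambda:\mathcal L(\mathcal H_{\mathrm{in}})\to\mathcal L(\mathcal H_{\mathrm{out}})$ that is purifying and reversible on $\mathcal M$ (i.e. $\operatorname{tr}(\Lambda[\rho]^2)=1$ for all $\rho\in\mathcal M$, and there is a CPTP map $\Lambda':\mathcal L(\mathcal H_{\mathrm{out}})\to\mathcal L(\mathcal H_{\mathrm{in}})$ with $(\Lambda'\circ\Lambda)[\rho]=\rho$ for all $\rho\in\mathcal M$) if and only if $\mathcal M=\bigcup_i\mathcal M_i$ where $\mathcal M_i\perp\mathcal M_j$ for $i\neq j$ and each $\mathcal M_i$ is essentially pure; that is, for each $i$ there exist finite-dimensional Hilbert spaces $\mathcal H_C^i,\mathcal H_A^i,\mathcal H_B^i$ with $\mathcal H_{\mathrm{in}}\otimes\mathcal H_C^i\cong\mathcal H_A^i\otimes\mathcal H_B^i$, density operators $\sigma_B^i\in\mathcal D(\mathcal H_B^i)$, $\omega_C^i\in\mathcal D(\mathcal H_C^i)$, and a unitary $U_i$ (from $\mathcal H_A^i\otimes\mathcal H_B^i$ to $\mathcal H_{\mathrm{in}}\otimes\mathcal H_C^i$) such that $$\{\rho\otimes\omega_C^i\mid\rho\in\mathcal M_i\}\subseteq\{U_i(|\phi\rangle\langle\phi|\otimes\sigma_B^i)U_i^\dagger\mid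 |\phi\rangle\in\mathcal H_A^i,\ \|\phi\|=1\}.$$
   Context: $\mathcal D(\mathcal H)$ denotes the set of density operators (positive semidefinite, trace one) on a finite-dimensional complex Hilbert space $\mathcal H$, and $\mathcal L(\mathcal H)$ the space of linear operators on $\mathcal H$. CPTP means completely positive and trace preserving linear map. For sets of states, $\mathcal M_i\perp\mathcal M_j$ means $\operatorname{tr}(\rho\sigma)=0$ for all $\rho\in\mathcal M_i$, $\sigma\in\mathcal M_j$. *)

theory Defs
  imports "Jordan_Normal_Form.Matrix" "Jordan_Normal_Form.Conjugate"
begin

text \<open>Finite-dimensional complex Hilbert spaces are modelled as C^n (n :: nat);
  operators on C^n are complex n x n matrices (carrier_mat n n).\<close>

definition mtrace :: "complex mat \<Rightarrow> complex" where
  "mtrace A = (\<Sum>i<dim_row A. A $$ (i, i))"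

definition adj :: "complex mat \<Rightarrow> complex mat" where
  "adj A = mat (dim_col A) (dim_row A) (\<lambda>(i, j). cnj (A $$ (j, i)))"

definition cinner :: "complex vec \<Rightarrow> complex vec \<Rightarrow> complex" where
  "cinner v w = (\<Sum>i<dim_vec v. cnj (v $ i) * w $ i)"

text \<open>Positive semidefinite operator on C^n (order on complex: Complex_Order).\<close>
definition psd :: "nat \<Rightarrow> complex mat \<Rightarrow> bool" where
  "psd n A \<longleftrightarrow> A \<in> carrier_mat n n \<and> adj A = A \<and>
     (\<forall>v \<in> carrier_vec n. 0 \<le> cinner v (A *\<^sub>v v))"

definition density :: "nat \<Rightarrow> complex mat \<Rightarrow> bool" where
  "density n \<rho> \<longleftrightarrow> psd n \<rho> \<and> mtrace \<rho> = 1"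

definition unitary_mat :: "nat \<Rightarrow> nat \<Rightarrow> complex mat \<Rightarrow> bool" where
  "unitary_mat m n U \<longleftrightarrow> U \<in> carrier_mat m n \<and> U * adj U = 1\<^sub>m m \<and> adj U * U = 1\<^sub>m n"

definition kron :: "complex mat \<Rightarrow> complex mat \<Rightarrow> complex mat" where
  "kron A B = mat (dim_row A * dim_row B) (dim_col A * dim_col B)
     (\<lambda>(i, j). A $$ (i div dim_row B, j div dim_col B) * B $$ (i mod dim_row B, j mod dim_col B))"

definition outer :: "complex vec \<Rightarrow> complex mat" where
  "outer \<phi> = mat (dim_vec \<phi>) (dim_vec \<phi>) (\<lambda>(i, j). \<phi> $ i * cnj (\<phi> $ j))"

definition unit_vec_c :: "nat \<Rightarrow> complex vec \<Rightarrow> bool" where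
  "unit_vec_c n \<phi> \<longleftrightarrow> \<phi> \<in> carrier_vec n \<and> cinner \<phi> \<phi> = 1"

definition blk :: "nat \<Rightarrow> nat \<Rightarrow> nat \<Rightarrow> complex mat \<Rightarrow> complex mat" where
  "blk n a b X = mat n n (\<lambda>(p, q). X $$ (a * n + p, b * n + q))"

text \<open>id_k \<otimes> \<Lambda> for \<Lambda> : L(C^n) \<rightarrow> L(C^m), acting on L(C^k \<otimes> C^n).\<close>
definition lift :: "nat \<Rightarrow> nat \<Rightarrow> nat \<Rightarrow> (complex mat \<Rightarrow> complex mat) \<Rightarrow> complex mat \<Rightarrow> complex mat" where
  "lift k n m \<Lambda> X = mat (k * m) (k * m)
     (\<lambda>(i, j). \<Lambda> (blk n (i div m) (j div m) X) $$ (i mod m, j mod m))"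

definition cptp :: "nat \<Rightarrow> nat \<Rightarrow> (complex mat \<Rightarrow> complex mat) \<Rightarrow> bool" where
  "cptp n m \<Lambda> \<longleftrightarrow>
     (\<forall>X \<in> carrier_mat n n. \<Lambda> X \<in> carrier_mat m m) \<and>
     (\<forall>X \<in> carrier_mat n n. \<forall>Y \<in> carrier_mat n n. \<Lambda> (X + Y) = \<Lambda> X + \<Lambda> Y) \<and>
     (\<forall>c. \<forall>X \<in> carrier_mat n n. \<Lambda> (c \<cdot>\<^sub>m X) = c \<cdot>\<^sub>m \<Lambda> X) \<and>
     (\<forall>k X. psd (k * n) X \<longrightarrow> psd (k * m) (lift k n m \<Lambda> X)) \<and>
     (\<forall>X \<in> carrier_mat n n. mtrace (\<Lambda> X) = mtrace X)"

definition orth_sets :: "complex mat set \<Rightarrow> complex mat set \<Rightarrow> bool" where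
  "orth_sets A B \<longleftrightarrow> (\<forall>\<rho>\<in>A. \<forall>\<sigma>\<in>B. mtrace (\<rho> * \<sigma>) = 0)"

text \<open>Essentially pure set of states on C^n (dimensions dC, dA, dB of H_C, H_A, H_B;
  H_in \<otimes> H_C \<cong> H_A \<otimes> H_B is witnessed by the unitary U).\<close>
definition essentially_pure :: "nat \<Rightarrow> complex mat set \<Rightarrow> bool" where
  "essentially_pure n S \<longleftrightarrow>
     (\<exists>dC dA dB \<sigma> \<omega> U. n * dC = dA * dB \<and> density dB \<sigma> \<and> density dC \<omega> \<and>
        unitary_mat (n * dC) (dA * dB) U \<and>
        {kron \<rho> \<omega> | \<rho>. \<rho> \<in> S} \<subseteq>
          {U * kron (outer \<phi>) \<sigma> * adj U | \<phi>. unit_vec_c dA \<phi>})"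

end

theory Submission
  imports Defs "Jordan_Normal_Form.Determinant"
begin

text \<open>Vectors are handled as matrices with one column, and in a tensor product the second factor is
  the minor index.

  For a reversible purification take Stinespring isometries \<open>V\<close> of \<open>\<Lambda>\<close> and \<open>W\<close> of \<open>\<Lambda>'\<close>, and let
  \<open>Z = (V \<otimes> 1) W\<close>, which dilates \<open>\<Lambda> \<circ> \<Lambda>'\<close>. If \<open>\<Lambda> \<rho>\<close> is the pure state of \<open>\<psi>\<close>, then \<open>\<Lambda> \<circ> \<Lambda>'\<close> fixes it, so
  \<open>Z \<psi> = \<psi> \<otimes> c\<close>, and tracing out the environment of \<open>W\<close> gives \<open>V \<rho> V\<^sup>* = \<psi> \<psi>\<^sup>* \<otimes> \<eta>\<close> with \<open>\<eta>\<close> depending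
  on \<open>c\<close> only. As \<open>Z\<close> is isometric, states with different \<open>c\<close> are orthogonal, so the values of \<open>c\<close>
  give the decomposition; an extension of \<open>V\<close> to a unitary shows that its parts are essentially pure.

  Conversely, an essentially pure set is purified by attaching \<open>\<omega>\<close>, applying \<open>U\<^sup>*\<close> and tracing out
  \<open>H\<^sub>B\<close>. Two orthogonal sets are combined by first projecting onto the support of one of them and its
  complement, and only finitely many parts are nonempty.\<close>

subsection \<open>Matrix algebra\<close>

text \<open>Completing \<open>V\<close>, from C^n to C^(m k), to a unitary with a fixed ancilla
  state would ask that n divide m k. Instead H_C is C^(m k) itself and H_B is C^k \<otimes> C^n, so
  the dimensions agree for every n; the ancilla states are \<open>V * \<tau> * adj V\<close> on H_C
  and \<eta> \<otimes> \<tau> on H_B, for any one state \<tau> of the part.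

  Parts are separated because the dilation gives <\<psi>, \<phi>> = <\<psi>, \<phi>> <c, d>, and
  unit vectors c, d with inner product 1 are equal. Finiteness matters twice: for numbering the
  parts that are found, and for building a channel by adding one part at a time. Both times it is
  the bound on the size of an orthonormal family.

  The sets of states may be infinite, so the projection that separates two of them is found by
  maximality of a dimension and not from an average state.

  Eigenvalues never occur. A positive matrix is factored as \<open>G * adj G\<close> by eliminating
  pivots; factors of this kind give the Kraus operators, the positivity of tensor products and
  partial traces, and the product zero of orthogonal states, while elimination itself recognises
  pure states.\<close>

lemma sum_lessThan_mult:
  fixes f :: "nat \<Rightarrow> 'a::comm_monoid_add"
  shows "(\<Sum>i<a * b. f i) = (\<Sum>i<a. \<Sum>j<b. f (i * b + j))"
proof (induction a)
  case (Suc a)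
  have split: "(\<Sum>i<m + b. f i) = (\<Sum>i<m. f i) + (\<Sum>j<b. f (m + j))" for m
    by (induction b) (simp_all add: add.assoc)
  have "(\<Sum>i<Suc a * b. f i) = (\<Sum>i<a * b + b. f i)"
    by (simp add: add.commute)
  also have "\<dots> = (\<Sum>i<a * b. f i) + (\<Sum>j<b. f (a * b + j))"
    by (rule split)
  finally show ?case using Suc by simp
qed simp

lemma index_mult_less:
  fixes i j a b :: nat
  assumes "i < a" "j < b"
  shows "i * b + j < a * b"
proof -
  have "i * b + j < Suc i * b" using assms by simp
  also have "\<dots> \<le> a * b" using assms by (intro mult_le_mono1) simp
  finally show ?thesis .
qed

lemma div_mod_less:
  fixes i a b :: nat
  assumes "i < a * b"
  shows "i div b < a" "i mod b < b"
  using assms by (auto simp: less_mult_imp_div_less intro!: mod_less_divisor Nat.gr0I)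

lemma div_mod_index [simp]:
  fixes i j b :: nat
  assumes "j < b"
  shows "(i * b + j) div b = i" "(i * b + j) mod b = j"
  using assms by auto

lemma mod_mult_div: "(i::nat) mod (b * c) div c = i div c mod b"
proof (cases "c = 0")
  case False
  have "i mod (b * c) = c * (i div c mod b) + i mod c"
    using mod_mult2_eq[of i c b] by (simp add: mult.commute)
  then show ?thesis using False by simp
qed simp

lemma mod_mult_mod: "(i::nat) mod (b * c) mod c = i mod c"
  by (simp add: mod_mod_cancel)

lemma div_mult_div: "(i::nat) div (b * c) = i div c div b"
  by (metis div_mult2_eq mult.commute)

lemma mult_index:
  assumes "dim_col A = dim_row B" "i < dim_row A" "j < dim_col B"
  shows "(A * B) $$ (i, j) = (\<Sum>k<dim_row B. A $$ (i, k) * B $$ (k, j))"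
  using assms by (auto simp: scalar_prod_def lessThan_atLeast0 intro!: sum.cong)

text \<open>In this rule and the next ones the side conditions are equations between dimensions,
  which the simplifier decides by itself, so long products are normalised by rewriting without
  naming carriers.\<close>

lemma mult_assoc_dim:
  "dim_col A = dim_row B \<Longrightarrow> dim_col B = dim_row C \<Longrightarrow> (A * B) * C = A * (B * C)"
  for A :: "complex mat"
  by (rule assoc_mult_mat[of _ "dim_row A" "dim_col A" _ "dim_col B" _ "dim_col C"]) auto

lemma add_mult_dim:
  "dim_row A = dim_row B \<Longrightarrow> dim_col A = dim_col B \<Longrightarrow> dim_col B = dim_row C \<Longrightarrow>
    (A + B) * C = A * C + B * C"
  for A :: "complex mat"
  by (rule add_mult_distrib_mat[of _ "dim_row A" "dim_col A" _ _ "dim_col C"]) auto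

lemma mult_add_dim:
  "dim_row B = dim_row C \<Longrightarrow> dim_col B = dim_col C \<Longrightarrow> dim_col A = dim_row B \<Longrightarrow>
    A * (B + C) = A * B + A * C"
  for A :: "complex mat"
  by (rule mult_add_distrib_mat[of _ "dim_row A" "dim_col A" _ "dim_col B"]) auto

lemma diff_mult_dim:
  "dim_row A = dim_row B \<Longrightarrow> dim_col A = dim_col B \<Longrightarrow> dim_col B = dim_row C \<Longrightarrow>
    (A - B) * C = A * C - B * C"
  for A :: "complex mat"
  by (rule minus_mult_distrib_mat[of _ "dim_row A" "dim_col A" _ _ "dim_col C"]) auto

lemma mult_diff_dim:
  "dim_row B = dim_row C \<Longrightarrow> dim_col B = dim_col C \<Longrightarrow> dim_col A = dim_row B \<Longrightarrow>
    A * (B - C) = A * B - A * C"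
  for A :: "complex mat"
  by (rule mult_minus_distrib_mat[of _ "dim_row A" "dim_col A" _ "dim_col B"]) auto

lemma mult_one_dim: "dim_col A = n \<Longrightarrow> A * 1\<^sub>m n = A" for A :: "complex mat"
  by (rule right_mult_one_mat[of _ "dim_row A"]) auto

lemma one_mult_dim: "dim_row A = n \<Longrightarrow> 1\<^sub>m n * A = A" for A :: "complex mat"
  by (rule left_mult_one_mat[of _ _ "dim_col A"]) auto

lemma smult_mult_dim: "dim_col A = dim_row B \<Longrightarrow> (c \<cdot>\<^sub>m A) * B = c \<cdot>\<^sub>m (A * B)"
  for A :: "complex mat"
  by (rule mult_smult_assoc_mat[of _ "dim_row A" "dim_col A" _ "dim_col B"]) auto

lemma mult_smult_dim: "dim_col A = dim_row B \<Longrightarrow> A * (c \<cdot>\<^sub>m B) = c \<cdot>\<^sub>m (A * B)"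
  for A :: "complex mat"
  by (rule mult_smult_distrib[of _ "dim_row A" "dim_col A" _ "dim_col B"]) auto

lemma zero_dims [simp]:
  fixes A :: "complex mat"
  shows "dim_row A = m \<Longrightarrow> dim_col A = n \<Longrightarrow> A - 0\<^sub>m m n = A"
    "dim_row A = m \<Longrightarrow> dim_col A = n \<Longrightarrow> A + 0\<^sub>m m n = A"
    "dim_row A = m \<Longrightarrow> dim_col A = n \<Longrightarrow> 0\<^sub>m m n + A = A"
    "A - A = 0\<^sub>m (dim_row A) (dim_col A)"
    "dim_row A = n \<Longrightarrow> 0\<^sub>m m n * A = 0\<^sub>m m (dim_col A)"
    "dim_col A = n \<Longrightarrow> A * 0\<^sub>m n k = 0\<^sub>m (dim_row A) k"
  by (auto intro!: eq_matI simp: scalar_prod_def)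

lemma one_smult_complex_mat [simp]: "1 \<cdot>\<^sub>m A = A" for A :: "complex mat"
  by (rule eq_matI) auto

lemma dim_adj [simp]: "dim_row (adj A) = dim_col A" "dim_col (adj A) = dim_row A"
  by (simp_all add: adj_def)

lemma adj_carrier [simp]: "A \<in> carrier_mat m n \<Longrightarrow> adj A \<in> carrier_mat n m"
  by (intro carrier_matI) auto

lemma adj_index [simp]: "i < dim_col A \<Longrightarrow> j < dim_row A \<Longrightarrow> adj A $$ (i, j) = cnj (A $$ (j, i))"
  by (simp add: adj_def)

lemma adj_adj [simp]: "adj (adj A) = A"
  by (rule eq_matI) auto

lemma adj_one [simp]: "adj (1\<^sub>m n) = 1\<^sub>m n"
  by (rule eq_matI) auto

lemma adj_zero [simp]: "adj (0\<^sub>m m n) = 0\<^sub>m n m"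
  by (rule eq_matI) auto

lemma adj_add: "dim_row A = dim_row B \<Longrightarrow> dim_col A = dim_col B \<Longrightarrow> adj (A + B) = adj A + adj B"
  by (rule eq_matI) auto

lemma adj_diff: "dim_row A = dim_row B \<Longrightarrow> dim_col A = dim_col B \<Longrightarrow> adj (A - B) = adj A - adj B"
  by (rule eq_matI) auto

lemma adj_mult: "dim_col A = dim_row B \<Longrightarrow> adj (A * B) = adj B * adj A"
  by (rule eq_matI) (auto simp: mult_index mult.commute simp del: index_mult_mat(1))

lemma mtrace_mult:
  assumes "A \<in> carrier_mat m n" "B \<in> carrier_mat n m"
  shows "mtrace (A * B) = (\<Sum>i<m. \<Sum>k<n. A $$ (i, k) * B $$ (k, i))"
  using assms by (auto simp: mtrace_def mult_index simp del: index_mult_mat(1))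

lemma mtrace_comm:
  assumes "dim_col A = dim_row B" "dim_row A = dim_col B"
  shows "mtrace (A * B) = mtrace (B * A)"
proof -
  have "mtrace (A * B) = (\<Sum>i<dim_row A. \<Sum>k<dim_row B. A $$ (i, k) * B $$ (k, i))"
    by (rule mtrace_mult) (use assms in auto)
  also have "\<dots> = (\<Sum>k<dim_row B. \<Sum>i<dim_row A. B $$ (k, i) * A $$ (i, k))"
    by (subst sum.swap) (simp add: mult.commute)
  also have "\<dots> = mtrace (B * A)"
    by (rule mtrace_mult[symmetric]) (use assms in auto)
  finally show ?thesis .
qed

lemma mtrace_add: "dim_row A = dim_row B \<Longrightarrow> dim_col B = dim_row B \<Longrightarrow>
    mtrace (A + B) = mtrace A + mtrace B"
  by (simp add: mtrace_def sum.distrib)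

lemma mtrace_conj:
  assumes "V \<in> carrier_mat m n" "adj V * V = 1\<^sub>m n" "X \<in> carrier_mat n n"
  shows "mtrace (V * X * adj V) = mtrace X"
proof -
  have "mtrace (V * X * adj V) = mtrace (adj V * (V * X))"
    by (rule mtrace_comm) (use assms in auto)
  also have "adj V * (V * X) = (adj V * V) * X"
    by (rule mult_assoc_dim[symmetric]) (use assms in auto)
  finally show ?thesis using assms by (simp add: one_mult_dim)
qed

lemma mtrace_mult_adj_nonneg: "0 \<le> mtrace (A * adj A)"
  by (subst mtrace_mult[of _ "dim_row A" "dim_col A"])
    (auto intro!: sum_nonneg simp: complex_mult_cnj less_eq_complex_def)

lemma mult_adj_index:
  assumes "i < dim_row A" "j < dim_row B" "dim_col A = dim_col B"
  shows "(A * adj B) $$ (i, j) = (\<Sum>k<dim_col A. A $$ (i, k) * cnj (B $$ (j, k)))"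
  using assms by (auto simp: mult_index simp del: index_mult_mat(1) intro!: sum.cong)

text \<open>The trace is the squared Hilbert-Schmidt norm, the sum of the squared moduli of the
  entries. This is the way in which matrix equations are drawn from trace equations below.\<close>

lemma mtrace_mult_adj_eq_0:
  assumes "mtrace (A * adj A) = 0"
  shows "A = 0\<^sub>m (dim_row A) (dim_col A)"
proof -
  have "mtrace (A * adj A) = (\<Sum>i<dim_row A. \<Sum>k<dim_col A. of_real ((cmod (A $$ (i, k)))\<^sup>2))"
    by (subst mtrace_mult[of _ "dim_row A" "dim_col A"])
      (auto simp: complex_mult_cnj cmod_power2 intro!: sum.cong)
  then have "(\<Sum>i<dim_row A. \<Sum>k<dim_col A. (cmod (A $$ (i, k)))\<^sup>2) = 0"
    using assms by (simp flip: of_real_sum of_real_power)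
  then have "\<forall>i<dim_row A. \<forall>k<dim_col A. A $$ (i, k) = 0"
    by (subst (asm) sum_nonneg_eq_0_iff) (auto intro!: sum_nonneg simp: sum_nonneg_eq_0_iff)
  then show ?thesis by (intro eq_matI) auto
qed

subsection \<open>Positive semidefinite matrices\<close>

text \<open>With one-column matrices, inner products, rank-one operators and application of an
  operator are all matrix products with \<open>adj\<close>, so one set of algebraic rules serves
  them; an inner product is a 1 x 1 matrix.\<close>

definition column_mat :: "complex vec \<Rightarrow> complex mat" where
  "column_mat v = mat (dim_vec v) 1 (\<lambda>(i, _). v $ i)"

lemma column_mat_carrier [simp]: "v \<in> carrier_vec n \<Longrightarrow> column_mat v \<in> carrier_mat n 1"
  by (auto simp: column_mat_def)

lemma dim_column_mat [simp]: "dim_row (column_mat v) = dim_vec v" "dim_col (column_mat v) = 1"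
  by (simp_all add: column_mat_def)

lemma column_mat_surj:
  assumes "u \<in> carrier_mat n 1"
  obtains v where "v \<in> carrier_vec n" "u = column_mat v"
proof
  show "vec n (\<lambda>i. u $$ (i, 0)) \<in> carrier_vec n" by simp
  show "u = column_mat (vec n (\<lambda>i. u $$ (i, 0)))"
    by (rule eq_matI) (use assms in \<open>auto simp: column_mat_def\<close>)
qed

lemma outer_column_mat: "outer v = column_mat v * adj (column_mat v)"
  by (rule eq_matI) (auto simp: outer_def column_mat_def mult_adj_index simp del: index_mult_mat(1))

lemma cinner_column_mat:
  assumes "dim_vec v = dim_vec w"
  shows "cinner v w = (adj (column_mat v) * column_mat w) $$ (0, 0)"
  using assms
  by (auto simp: cinner_def mult_index column_mat_def simp del: index_mult_mat(1) intro!: sum.cong)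

lemma column_mat_mult_vec:
  assumes "dim_col A = dim_vec v"
  shows "column_mat (A *\<^sub>v v) = A * column_mat v"
  by (rule eq_matI) (use assms in \<open>auto simp: column_mat_def scalar_prod_def\<close>)

lemma psd_iff:
  "psd n A \<longleftrightarrow> A \<in> carrier_mat n n \<and> adj A = A \<and>
     (\<forall>v \<in> carrier_mat n 1. 0 \<le> (adj v * (A * v)) $$ (0, 0))"
proof -
  have eq: "cinner v (A *\<^sub>v v) = (adj (column_mat v) * (A * column_mat v)) $$ (0, 0)"
    if "A \<in> carrier_mat n n" "v \<in> carrier_vec n" for v
    using that by (subst cinner_column_mat) (auto simp: column_mat_mult_vec)
  show ?thesis
    unfolding psd_def using eq
    by (metis column_mat_carrier column_mat_surj)
qed

lemma unit_vec_c_iff: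
  "unit_vec_c n v \<longleftrightarrow> v \<in> carrier_vec n \<and> adj (column_mat v) * column_mat v = 1\<^sub>m 1"
proof -
  have "adj (column_mat v) * column_mat v = 1\<^sub>m 1 \<longleftrightarrow> (adj (column_mat v) * column_mat v) $$ (0, 0) = 1"
  proof
    assume "(adj (column_mat v) * column_mat v) $$ (0, 0) = 1"
    then show "adj (column_mat v) * column_mat v = 1\<^sub>m 1"
      by (intro eq_matI) (auto simp del: index_mult_mat(1))
  qed simp
  then show ?thesis
    unfolding unit_vec_c_def by (simp add: cinner_column_mat)
qed

lemma psd_carrier: "psd n A \<Longrightarrow> A \<in> carrier_mat n n"
  by (simp add: psd_def)

text \<open>The quadratic form at \<open>v\<close> is the squared norm of \<open>adj G * v\<close>,
  read as the trace of a 1 x 1 matrix.\<close>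

lemma psd_mult_adj:
  assumes "G \<in> carrier_mat n k"
  shows "psd n (G * adj G)"
  unfolding psd_iff
proof (intro conjI ballI)
  show "G * adj G \<in> carrier_mat n n" using assms by auto
  show "adj (G * adj G) = G * adj G" by (simp add: adj_mult)
  fix v :: "complex mat" assume v: "v \<in> carrier_mat n 1"
  have "adj v * (G * adj G * v) = (adj v * G) * adj (adj v * G)"
    using assms v by (simp add: mult_assoc_dim adj_mult)
  then have "mtrace (adj v * (G * adj G * v)) \<ge> 0"
    by (simp add: mtrace_mult_adj_nonneg)
  then show "0 \<le> (adj v * (G * adj G * v)) $$ (0, 0)"
    using v by (simp add: mtrace_def del: index_mult_mat(1))
qed

lemma psd_conj:
  assumes "psd n A" "T \<in> carrier_mat m n"
  shows "psd m (T * A * adj T)"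
  unfolding psd_iff
proof (intro conjI ballI)
  have A: "A \<in> carrier_mat n n" "adj A = A" using assms by (auto simp: psd_def)
  show "T * A * adj T \<in> carrier_mat m m" using assms by auto
  show "adj (T * A * adj T) = T * A * adj T" using A assms by (simp add: adj_mult mult_assoc_dim)
  fix v :: "complex mat" assume v: "v \<in> carrier_mat m 1"
  have "adj v * (T * A * adj T * v) = adj (adj T * v) * (A * (adj T * v))"
    using assms v A by (simp add: mult_assoc_dim adj_mult)
  moreover have "adj T * v \<in> carrier_mat n 1" using assms v by auto
  ultimately show "0 \<le> (adj v * (T * A * adj T * v)) $$ (0, 0)"
    using assms(1) by (auto simp: psd_iff simp del: index_mult_mat(1))
qed

lemma psd_add:
  assumes "psd n A" "psd n B"
  shows "psd n (A + B)"
  unfolding psd_iff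
proof (intro conjI ballI)
  have c: "A \<in> carrier_mat n n" "B \<in> carrier_mat n n" using assms by (auto simp: psd_def)
  show "A + B \<in> carrier_mat n n" using c by auto
  show "adj (A + B) = A + B" using assms c by (simp add: adj_add psd_def)
  fix v :: "complex mat" assume v: "v \<in> carrier_mat n 1"
  have "adj v * ((A + B) * v) = adj v * (A * v) + adj v * (B * v)"
    using c v by (simp add: add_mult_dim mult_add_dim)
  then show "0 \<le> (adj v * ((A + B) * v)) $$ (0, 0)"
    using assms v by (auto simp: psd_iff simp del: index_mult_mat(1))
qed

lemma psd_herm:
  assumes "psd n A" "i < n" "j < n"
  shows "cnj (A $$ (i, j)) = A $$ (j, i)"
proof -
  have "adj A $$ (j, i) = A $$ (j, i)" "A \<in> carrier_mat n n"
    using assms by (auto simp: psd_def)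
  then show ?thesis using assms by auto
qed

lemma psd_quad:
  assumes "psd n A"
  shows "0 \<le> (\<Sum>i<n. cnj (x i) * (\<Sum>j<n. A $$ (i, j) * x j))"
proof -
  let ?v = "mat n 1 (\<lambda>(i, _). x i)"
  have A: "A \<in> carrier_mat n n" using assms by (rule psd_carrier)
  have "0 \<le> (adj ?v * (A * ?v)) $$ (0, 0)" using assms by (simp add: psd_iff)
  also have "(adj ?v * (A * ?v)) $$ (0, 0) = (\<Sum>i<n. cnj (x i) * (\<Sum>j<n. A $$ (i, j) * x j))"
    using A by (simp add: mult_index del: index_mult_mat(1))
  finally show ?thesis .
qed

text \<open>Kronecker deltas are written with \<open>of_bool\<close>; these rules collapse the sums
  in which they occur.\<close>

lemma sum_of_bool:
  fixes f :: "nat \<Rightarrow> 'a::semiring_1"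
  assumes "i < n"
  shows "(\<Sum>p<n. f p * of_bool (p = i)) = f i" "(\<Sum>p<n. of_bool (p = i) * f p) = f i"
  using assms by (simp_all add: of_bool_def if_distrib if_distribR cong: if_cong)

lemma cnj_of_bool [simp]: "cnj (of_bool b) = of_bool b"
  by (cases b) auto

lemma psd_diag:
  assumes "psd n A" "i < n"
  shows "0 \<le> A $$ (i, i)"
proof -
  have "0 \<le> (\<Sum>p<n. cnj (of_bool (p = i)) * (\<Sum>q<n. A $$ (p, q) * of_bool (q = i)))"
    by (rule psd_quad[OF assms(1)])
  also have "\<dots> = A $$ (i, i)"
    using assms by (simp add: sum_of_bool)
  finally show ?thesis .
qed

lemma psd_zero_diag:
  assumes "psd n A" "i < n" "j < n" "A $$ (i, i) = 0" "A $$ (j, j) = 0"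
  shows "A $$ (i, j) = 0"
proof (cases "i = j")
  case False
  \<comment> \<open>Test vector e_i + z e_j. As both diagonal entries vanish, the form there is
    twice the real part of \<open>A $$ (i, j) * z\<close>, and this choice of \<open>z\<close> makes
    it -2 |A_ij|^2.\<close>
  define z where "z = - A $$ (j, i)"
  have inner: "(\<Sum>q<n. A $$ (p, q) * (of_bool (q = i) + z * of_bool (q = j))) = A $$ (p, i) + z * A $$ (p, j)" for p
  proof -
    have "(\<Sum>q<n. A $$ (p, q) * (of_bool (q = i) + z * of_bool (q = j))) =
        (\<Sum>q<n. A $$ (p, q) * of_bool (q = i)) + (\<Sum>q<n. (z * A $$ (p, q)) * of_bool (q = j))"
      by (simp add: sum.distrib distrib_left mult_ac)
    then show ?thesis by (simp only: sum_of_bool assms)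
  qed
  have "0 \<le> (\<Sum>p<n. cnj (of_bool (p = i) + z * of_bool (p = j)) *
      (\<Sum>q<n. A $$ (p, q) * (of_bool (q = i) + z * of_bool (q = j))))"
    by (rule psd_quad[OF assms(1)])
  also have "\<dots> =
      (\<Sum>p<n. of_bool (p = i) * (A $$ (p, i) + z * A $$ (p, j))) +
      (\<Sum>p<n. of_bool (p = j) * (cnj z * (A $$ (p, i) + z * A $$ (p, j))))"
    unfolding inner by (simp add: sum.distrib distrib_right mult_ac)
  also have "\<dots> = A $$ (i, j) * z + cnj z * A $$ (j, i)"
    by (simp only: sum_of_bool assms) (simp add: assms)
  also have "\<dots> = - of_real (2 * (cmod (A $$ (i, j)))\<^sup>2)"
    unfolding z_def using psd_herm[OF assms(1,2,3), symmetric]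
    by (simp flip: complex_norm_square)
  finally show ?thesis by (simp add: less_eq_complex_def)
qed (use assms in auto)

section \<open>Schur complements, Gram factorisation and pure states\<close>

definition schur_compl :: "nat \<Rightarrow> nat \<Rightarrow> complex mat \<Rightarrow> complex mat" where
  "schur_compl n i A = mat n n (\<lambda>(p, q). A $$ (p, q) - A $$ (p, i) * A $$ (i, q) / A $$ (i, i))"

text \<open>\<open>T\<close> is the elimination matrix that subtracts multiples of row i from all
  rows. \<open>T * A\<close> is already the Schur complement, whose column i is zero, so multiplying
  by \<open>adj T\<close> on the right changes nothing and the complement is congruent to
  \<open>A\<close>. Row and column i are zeroed and not removed, which keeps the size n and avoids
  reindexing.\<close>

lemma psd_schur_compl:
  assumes "psd n A" "i < n" "A $$ (i, i) \<noteq> 0"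
  shows "psd n (schur_compl n i A)"
proof -
  define T where "T = mat n n (\<lambda>(p, q). of_bool (p = q) - of_bool (q = i) * A $$ (p, i) / A $$ (i, i))"
  have A: "A \<in> carrier_mat n n" using assms psd_carrier by auto
  have T: "T \<in> carrier_mat n n" by (simp add: T_def)
  have 1: "T * A = schur_compl n i A"
  proof (rule eq_matI)
    fix p q assume "p < dim_row (schur_compl n i A)" "q < dim_col (schur_compl n i A)"
    then have pq: "p < n" "q < n" by (auto simp: schur_compl_def)
    have "(T * A) $$ (p, q) = (\<Sum>k<n. of_bool (k = p) * A $$ (k, q)) -
        (\<Sum>k<n. of_bool (k = i) * (A $$ (p, i) / A $$ (i, i) * A $$ (k, q)))"
      using A pq unfolding sum_subtractf[symmetric]
      by (auto simp: mult_index T_def left_diff_distrib simp del: index_mult_mat(1) intro!: sum.cong)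
    then show "(T * A) $$ (p, q) = schur_compl n i A $$ (p, q)"
      using pq assms(2) by (simp only: sum_of_bool) (simp add: schur_compl_def)
  qed (use A T in \<open>auto simp: schur_compl_def\<close>)
  have 2: "schur_compl n i A * adj T = schur_compl n i A"
  proof (rule eq_matI)
    fix p q assume "p < dim_row (schur_compl n i A)" "q < dim_col (schur_compl n i A)"
    then have pq: "p < n" "q < n" by (auto simp: schur_compl_def)
    let ?Z = "schur_compl n i A"
    have "(?Z * adj T) $$ (p, q) = (\<Sum>k<dim_col ?Z. ?Z $$ (p, k) * cnj (T $$ (q, k)))"
      using A pq T by (intro mult_adj_index) (auto simp: schur_compl_def)
    also have "\<dots> = (\<Sum>k<n. ?Z $$ (p, k) * of_bool (k = q)) -
        (\<Sum>k<n. cnj (A $$ (q, i) / A $$ (i, i)) * ?Z $$ (p, k) * of_bool (k = i))"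
      unfolding sum_subtractf[symmetric]
      by (intro sum.cong) (use pq in \<open>auto simp: T_def schur_compl_def[of n i A] right_diff_distrib\<close>)
    finally show "(?Z * adj T) $$ (p, q) = ?Z $$ (p, q)"
      using pq assms(2,3) by (simp only: sum_of_bool) (simp add: schur_compl_def)
  qed (use A T in \<open>auto simp: schur_compl_def\<close>)
  show ?thesis using psd_conj[OF assms(1) T] by (simp add: 1 2)
qed

text \<open>For a nonzero pivot the minor is the pivot times a diagonal entry of the Schur
  complement, both nonnegative. The minor is symmetric in i and j, so either entry may be the pivot;
  if both are zero, the off-diagonal entries vanish too.\<close>

lemma psd_minor:
  assumes "psd n A" "i < n" "j < n"
  shows "0 \<le> A $$ (i, i) * A $$ (j, j) - A $$ (i, j) * A $$ (j, i)"
proof -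
  have *: "0 \<le> A $$ (i, i) * A $$ (j, j) - A $$ (i, j) * A $$ (j, i)"
    if "A $$ (i, i) \<noteq> 0" "i < n" "j < n" for i j
  proof -
    have "0 \<le> schur_compl n i A $$ (j, j)"
      using psd_diag psd_schur_compl assms(1) that by blast
    then have "0 \<le> A $$ (i, i) * (A $$ (j, j) - A $$ (j, i) * A $$ (i, j) / A $$ (i, i))"
      using that psd_diag[OF assms(1), of i] by (auto simp: schur_compl_def intro!: mult_nonneg_nonneg)
    also have "\<dots> = A $$ (i, i) * A $$ (j, j) - A $$ (i, j) * A $$ (j, i)"
      using that by (simp add: field_simps)
    finally show ?thesis .
  qed
  consider "A $$ (i, i) \<noteq> 0" | "A $$ (j, j) \<noteq> 0" | "A $$ (i, i) = 0" "A $$ (j, j) = 0" by blast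
  then show ?thesis
  proof cases
    case 2
    then show ?thesis using *[of j i] assms by (simp add: mult.commute)
  qed (use * assms psd_zero_diag[OF assms] in auto)
qed

definition append_col :: "complex mat \<Rightarrow> complex mat \<Rightarrow> complex mat" where
  "append_col G w = mat (dim_row G) (Suc (dim_col G))
     (\<lambda>(i, j). if j < dim_col G then G $$ (i, j) else w $$ (i, 0))"

lemma append_col_carrier: "G \<in> carrier_mat n k \<Longrightarrow> append_col G w \<in> carrier_mat n (Suc k)"
  by (auto simp: append_col_def)

lemma append_col_mult_adj:
  assumes "G \<in> carrier_mat n k" "w \<in> carrier_mat n 1"
  shows "append_col G w * adj (append_col G w) = G * adj G + w * adj w"
  by (rule eq_matI)
    (use assms in \<open>auto simp: mult_adj_index append_col_def simp del: index_mult_mat(1)\<close>)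

lemma schur_compl_column:
  assumes "psd n A" "i < n" "A $$ (i, i) \<noteq> 0"
  obtains w where "w \<in> carrier_mat n 1" "A = schur_compl n i A + w * adj w"
proof -
  obtain r where r: "A $$ (i, i) = of_real r" "r > 0"
    using psd_diag[OF assms(1,2)] assms(3)
    by (metis complex_is_Real_iff less_eq_complex_def of_real_Re of_real_0 zero_complex.sel(1,2)
      order_le_less)
  have A: "A \<in> carrier_mat n n" using assms psd_carrier by auto
  \<comment> \<open>Column i over the square root of the pivot, so that \<open>w * adj w\<close> is
    exactly the rank-one part that the elimination subtracts.\<close>
  define w where "w = mat n 1 (\<lambda>(p, _::nat). A $$ (p, i) / of_real (sqrt r))"
  have "A = schur_compl n i A + w * adj w"
    by (rule eq_matI) (use A assms(2) r psd_herm[OF assms(1), of _ i] in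
      \<open>auto simp: mult_adj_index w_def schur_compl_def simp flip: of_real_mult simp del: index_mult_mat(1)\<close>)
  then show ?thesis using that[of w] by (simp add: w_def)
qed

text \<open>Cholesky elimination, by induction on the number of nonzero diagonal entries. Each pivot
  contributes one column of \<open>G\<close>; when no pivot is left the matrix is zero and is
  factored by a matrix with no columns. It serves where a square root or a spectral decomposition
  would otherwise be taken.\<close>

lemma psd_Gram:
  assumes "psd n A"
  obtains k G where "G \<in> carrier_mat n k" "A = G * adj G"
proof -
  have "\<exists>k G. G \<in> carrier_mat n k \<and> A = G * adj G"
    using assms
  proof (induction "card {i. i < n \<and> A $$ (i, i) \<noteq> 0}" arbitrary: A rule: less_induct)
    case less
    have A: "A \<in> carrier_mat n n" using less psd_carrier by auto
    show ?case
    proof (cases "\<exists>i<n. A $$ (i, i) \<noteq> 0")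
      case False
      have "A = 0\<^sub>m n 0 * adj (0\<^sub>m n 0)"
        using False psd_zero_diag[OF less.prems] A
        by (intro eq_matI) (auto simp: mult_adj_index simp del: index_mult_mat(1))
      then show ?thesis by (intro exI[of _ 0] exI[of _ "0\<^sub>m n 0"]) auto
    next
      case True
      then obtain i where i: "i < n" "A $$ (i, i) \<noteq> 0" by blast
      let ?Z = "schur_compl n i A"
      have Z: "psd n ?Z" using psd_schur_compl less i by blast
      have "p < n \<and> A $$ (p, p) \<noteq> 0 \<and> p \<noteq> i" if p: "p < n" "?Z $$ (p, p) \<noteq> 0" for p
      proof -
        \<comment> \<open>No diagonal entry comes back to life: if entry p is zero, the minor of i
          and p forces \<open>A $$ (i, p)\<close> to vanish, so the elimination subtracts nothing
          there.\<close>
        have "A $$ (p, p) \<noteq> 0"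
        proof
          assume 0: "A $$ (p, p) = 0"
          then have "0 \<le> - (A $$ (i, p) * A $$ (p, i))"
            using psd_minor[OF less.prems, of i p] i p by auto
          also have "A $$ (i, p) * A $$ (p, i) = of_real ((cmod (A $$ (i, p)))\<^sup>2)"
            using psd_herm[OF less.prems i(1) p(1), symmetric] by (simp flip: complex_norm_square)
          finally have "A $$ (i, p) = 0" by (simp add: less_eq_complex_def)
          then show False using p i 0 by (auto simp: schur_compl_def)
        qed
        then show ?thesis using p i by (auto simp: schur_compl_def)
      qed
      then have "{p. p < n \<and> ?Z $$ (p, p) \<noteq> 0} \<subset> {p. p < n \<and> A $$ (p, p) \<noteq> 0}"
        using i by blast
      then have "card {p. p < n \<and> ?Z $$ (p, p) \<noteq> 0} < card {p. p < n \<and> A $$ (p, p) \<noteq> 0}"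
        by (intro psubset_card_mono) auto
      from less.hyps[OF this Z] obtain k G where G: "G \<in> carrier_mat n k" "?Z = G * adj G" by blast
      obtain w where w: "w \<in> carrier_mat n 1" "A = ?Z + w * adj w"
        using schur_compl_column less i by blast
      have "A = append_col G w * adj (append_col G w)"
        by (subst append_col_mult_adj[OF G(1) w(1)], subst w(2)) (simp add: G(2))
      then show ?thesis using append_col_carrier[OF G(1)] by blast
    qed
  qed
  then show ?thesis using that by blast
qed

text \<open>The 2 x 2 principal minors sum to (tr Y)^2 - tr(Y^2) = 0 and are nonnegative, so each
  one vanishes. Hence the Schur complement at any nonzero pivot has zero diagonal, is therefore
  zero, and only the rank-one part remains.\<close>

lemma pure_density:
  assumes "density n Y" "mtrace (Y * Y) = 1"
  obtains \<psi> where "\<psi> \<in> carrier_mat n 1" "adj \<psi> * \<psi> = 1\<^sub>m 1" "Y = \<psi> * adj \<psi>"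
proof -
  have psd: "psd n Y" and tr: "mtrace Y = 1" using assms by (auto simp: density_def)
  have Y: "Y \<in> carrier_mat n n" using psd psd_carrier by auto
  let ?m = "\<lambda>i j. Y $$ (i, i) * Y $$ (j, j) - Y $$ (i, j) * Y $$ (j, i)"
  have "(\<Sum>i<n. \<Sum>j<n. ?m i j) = mtrace Y * mtrace Y - mtrace (Y * Y)"
    unfolding mtrace_mult[OF Y Y] using Y by (simp add: sum_subtractf mtrace_def sum_product)
  then have 0: "(\<Sum>i<n. \<Sum>j<n. ?m i j) = 0" using assms tr by simp
  have row0: "(\<Sum>j<n. ?m i j) = 0" if "i < n" for i
    using 0 that by (subst (asm) sum_nonneg_eq_0_iff) (auto intro!: sum_nonneg psd_minor[OF psd, simplified])
  then have m0: "?m i j = 0" if "i < n" "j < n" for i j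
    using row0[OF that(1)] that
    by (subst (asm) sum_nonneg_eq_0_iff) (auto intro!: psd_minor[OF psd, simplified])
  obtain i where i: "i < n" "Y $$ (i, i) \<noteq> 0"
  proof -
    have "mtrace Y = 0" if "\<forall>i<n. Y $$ (i, i) = 0"
      using that Y by (simp add: mtrace_def)
    then show ?thesis using tr that by auto
  qed
  let ?Z = "schur_compl n i Y"
  have Z: "psd n ?Z" using psd_schur_compl psd i by blast
  have "?Z $$ (j, j) = 0" if "j < n" for j
    using m0[OF i(1) that] i that by (simp add: schur_compl_def field_simps)
  then have "?Z = 0\<^sub>m n n"
    using psd_zero_diag[OF Z] psd_carrier[OF Z] by (intro eq_matI) auto
  moreover obtain w where w: "w \<in> carrier_mat n 1" "Y = ?Z + w * adj w"
    using schur_compl_column psd i by blast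
  ultimately have Yw: "Y = w * adj w" by (simp add: left_add_zero_mat[of _ n n])
  have "mtrace (adj w * w) = 1"
    using mtrace_comm[of w "adj w"] w(1) tr Yw by simp
  then have "(adj w * w) $$ (0, 0) = 1" using w(1) by (simp add: mtrace_def)
  then have "adj w * w = 1\<^sub>m 1" using w(1) by (intro eq_matI) (auto simp del: index_mult_mat(1))
  then show ?thesis using that w Yw by blast
qed

text \<open>For A = \<open>G * adj G\<close> and B = \<open>H * adj H\<close> the trace is the
  squared Hilbert-Schmidt norm of \<open>adj G * H\<close>, a factor in the middle of
  \<open>A * B\<close>. Orthogonality in the sense of the trace thus becomes an algebraic
  identity.\<close>

lemma psd_mtrace_mult_eq_0:
  assumes "psd n A" "psd n B" "mtrace (A * B) = 0"
  shows "A * B = 0\<^sub>m n n"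
proof -
  obtain k G where G: "G \<in> carrier_mat n k" "A = G * adj G" using psd_Gram assms by blast
  obtain l H where H: "H \<in> carrier_mat n l" "B = H * adj H" using psd_Gram assms by blast
  let ?D = "adj H * G"
  have "mtrace (A * B) = mtrace (G * (adj G * H * adj H))"
    using G H by (simp add: mult_assoc_dim)
  also have "\<dots> = mtrace (adj (adj H * G) * adj H * G)"
    using G H by (subst mtrace_comm) (auto simp: mult_assoc_dim adj_mult)
  also have "\<dots> = mtrace (adj ?D * adj (adj ?D))"
    using G H by (simp add: mult_assoc_dim)
  finally have "adj ?D = 0\<^sub>m k l"
    using mtrace_mult_adj_eq_0[of "adj ?D"] assms(3) G H by simp
  then have "adj G * H = 0\<^sub>m k l" using G H by (simp add: adj_mult)
  moreover have "A * B = G * ((adj G * H) * adj H)" using G H by (simp add: mult_assoc_dim)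
  ultimately show ?thesis using G H
    by (metis adj_carrier left_mult_zero_mat right_mult_zero_mat)
qed

subsection \<open>Tensor products and partial traces\<close>

lemma dim_kron [simp]:
  "dim_row (kron A B) = dim_row A * dim_row B" "dim_col (kron A B) = dim_col A * dim_col B"
  by (simp_all add: kron_def)

lemma kron_carrier [simp]:
  "A \<in> carrier_mat a b \<Longrightarrow> B \<in> carrier_mat c d \<Longrightarrow> kron A B \<in> carrier_mat (a * c) (b * d)"
  by (intro carrier_matI) auto

lemma kron_index [simp]:
  "i < dim_row A * dim_row B \<Longrightarrow> j < dim_col A * dim_col B \<Longrightarrow>
    kron A B $$ (i, j) = A $$ (i div dim_row B, j div dim_col B) * B $$ (i mod dim_row B, j mod dim_col B)"
  by (simp add: kron_def)

lemma kron_mult: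
  assumes "dim_col A = dim_row C" "dim_col B = dim_row D"
  shows "kron A B * kron C D = kron (A * C) (B * D)"
proof (rule eq_matI)
  fix i j assume "i < dim_row (kron (A * C) (B * D))" "j < dim_col (kron (A * C) (B * D))"
  then have ij: "i < dim_row A * dim_row B" "j < dim_col C * dim_col D" by simp_all
  have "(kron A B * kron C D) $$ (i, j) = (\<Sum>k<dim_row C * dim_row D. kron A B $$ (i, k) * kron C D $$ (k, j))"
    using assms ij by (subst mult_index) auto
  also have "\<dots> = (\<Sum>k<dim_row C. \<Sum>l<dim_row D.
      (A $$ (i div dim_row B, k) * C $$ (k, j div dim_col D)) *
      (B $$ (i mod dim_row B, l) * D $$ (l, j mod dim_col D)))"
    unfolding sum_lessThan_mult using assms ij
    by (intro sum.cong) (auto simp: index_mult_less mult_ac)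
  also have "\<dots> = (A * C) $$ (i div dim_row B, j div dim_col D) * (B * D) $$ (i mod dim_row B, j mod dim_col D)"
    using assms div_mod_less[OF ij(1)] div_mod_less[OF ij(2)]
    by (simp add: mult_index sum_product del: index_mult_mat(1))
  finally show "(kron A B * kron C D) $$ (i, j) = kron (A * C) (B * D) $$ (i, j)"
    using ij by simp
qed auto

lemma adj_kron: "adj (kron A B) = kron (adj A) (adj B)"
  by (rule eq_matI) (auto simp: div_mod_less)

lemma kron_one: "kron (1\<^sub>m a) (1\<^sub>m b) = 1\<^sub>m (a * b)"
proof (rule eq_matI)
  fix i j assume "i < dim_row (1\<^sub>m (a * b) :: complex mat)" "j < dim_col (1\<^sub>m (a * b) :: complex mat)"
  then have "i < a * b" "j < a * b" by auto
  moreover have "i div b = j div b \<and> i mod b = j mod b \<longleftrightarrow> i = j"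
    by (metis div_mult_mod_eq)
  ultimately show "kron (1\<^sub>m a) (1\<^sub>m b) $$ (i, j) = 1\<^sub>m (a * b) $$ (i, j)"
    by (auto simp: div_mod_less)
qed auto

lemma kron_assoc: "kron (kron A B) C = kron A (kron B C)"
proof (rule eq_matI)
  fix i j assume "i < dim_row (kron A (kron B C))" "j < dim_col (kron A (kron B C))"
  then have ij: "i < dim_row A * dim_row B * dim_row C" "j < dim_col A * dim_col B * dim_col C"
    "i < dim_row A * (dim_row B * dim_row C)" "j < dim_col A * (dim_col B * dim_col C)"
    by (simp_all add: mult.assoc)
  then show "kron (kron A B) C $$ (i, j) = kron A (kron B C) $$ (i, j)"
    by (simp add: div_mod_less(1)[OF ij(1)] div_mod_less(1)[OF ij(2)] div_mod_less(2)[OF ij(3)]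
      div_mod_less(2)[OF ij(4)] mod_mult_div mod_mult_mod div_mult_div)
qed (simp_all add: mult.assoc)

lemma kron_add_right:
  "dim_row B = dim_row C \<Longrightarrow> dim_col B = dim_col C \<Longrightarrow> kron A (B + C) = kron A B + kron A C"
  by (rule eq_matI) (auto simp: div_mod_less distrib_left)

lemma kron_add_left:
  "dim_row A = dim_row B \<Longrightarrow> dim_col A = dim_col B \<Longrightarrow> kron (A + B) C = kron A C + kron B C"
  by (rule eq_matI) (auto simp: div_mod_less distrib_right)

lemma kron_smult_left: "kron (c \<cdot>\<^sub>m A) B = c \<cdot>\<^sub>m kron A B"
  by (rule eq_matI) (auto simp: div_mod_less)

lemma kron_zero_left: "kron (0\<^sub>m a b) B = 0\<^sub>m (a * dim_row B) (b * dim_col B)"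
  by (rule eq_matI) (auto simp: div_mod_less)

lemma mtrace_kron:
  assumes "A \<in> carrier_mat a a" "B \<in> carrier_mat b b"
  shows "mtrace (kron A B) = mtrace A * mtrace B"
  using assms by (simp add: mtrace_def sum_lessThan_mult sum_product index_mult_less)

lemma psd_kron:
  assumes "psd a A" "psd b B"
  shows "psd (a * b) (kron A B)"
proof -
  obtain k G where G: "G \<in> carrier_mat a k" "A = G * adj G" using psd_Gram assms by blast
  obtain l H where H: "H \<in> carrier_mat b l" "B = H * adj H" using psd_Gram assms by blast
  have "kron A B = kron G H * adj (kron G H)" using G H by (simp add: kron_mult adj_kron)
  then show ?thesis using psd_mult_adj[of "kron G H" "a * b" "k * l"] G H by simp
qed

lemma density_kron: "density a A \<Longrightarrow> density b B \<Longrightarrow> density (a * b) (kron A B)"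
  by (auto simp: density_def psd_kron psd_carrier mtrace_kron[of A a B b])

definition ptrace :: "nat \<Rightarrow> nat \<Rightarrow> complex mat \<Rightarrow> complex mat" where
  "ptrace n d X = mat n n (\<lambda>(p, q). \<Sum>b<d. X $$ (p * d + b, q * d + b))"

lemma dim_ptrace [simp]: "dim_row (ptrace n d X) = n" "dim_col (ptrace n d X) = n"
  by (simp_all add: ptrace_def)

lemma ptrace_carrier [simp]: "ptrace n d X \<in> carrier_mat n n"
  by (simp add: ptrace_def)

lemma ptrace_index [simp]:
  "p < n \<Longrightarrow> q < n \<Longrightarrow> ptrace n d X $$ (p, q) = (\<Sum>b<d. X $$ (p * d + b, q * d + b))"
  by (simp add: ptrace_def)

lemma mtrace_ptrace: "X \<in> carrier_mat (n * d) (n * d) \<Longrightarrow> mtrace (ptrace n d X) = mtrace X"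
  by (simp add: mtrace_def sum_lessThan_mult)

lemma ptrace_kron:
  assumes "A \<in> carrier_mat n n" "B \<in> carrier_mat d d"
  shows "ptrace n d (kron A B) = mtrace B \<cdot>\<^sub>m A"
  by (rule eq_matI)
    (use assms in \<open>auto simp: mtrace_def index_mult_less sum_distrib_right intro!: sum.cong\<close>)

text \<open>Lets the environments of the two dilations be traced out either one after the other or
  as a single system of dimension \<open>k * l\<close>.\<close>

lemma ptrace_ptrace: "ptrace m k (ptrace (m * k) l X) = ptrace m (k * l) X"
  by (rule eq_matI) (auto simp: sum_lessThan_mult index_mult_less distrib_right add.assoc mult.assoc)

lemma ptrace_kron_right:
  assumes "A \<in> carrier_mat m m" "B \<in> carrier_mat (k * l) (k * l)"
  shows "ptrace (m * k) l (kron A B) = kron A (ptrace k l B)"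
proof (rule eq_matI)
  fix i j assume "i < dim_row (kron A (ptrace k l B))" "j < dim_col (kron A (ptrace k l B))"
  then have ij: "i < m * k" "j < m * k" using assms by auto
  have "kron A B $$ (i * l + b, j * l + b) =
      A $$ (i div k, j div k) * B $$ (i mod k * l + b, j mod k * l + b)" if "b < l" for b
  proof -
    have "(i * l + b) mod (k * l) = i mod k * l + b" for i
      using mod_mult2_eq[of "i * l + b" l k] that by (simp add: mult.commute[of l])
    moreover have "(i * l + b) div (k * l) = i div k" for i
      using that by (simp add: div_mult_div)
    moreover have "i * l + b < m * (k * l)" "j * l + b < m * (k * l)"
      using index_mult_less[OF ij(1) that] index_mult_less[OF ij(2) that] by (simp_all add: mult.assoc)
    ultimately show ?thesis using assms by simp
  qed
  then show "ptrace (m * k) l (kron A B) $$ (i, j) = kron A (ptrace k l B) $$ (i, j)"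
    using ij assms by (simp add: sum_distrib_left div_mod_less)
qed (use assms in auto)

lemma kron_one_mult_index:
  assumes "V \<in> carrier_mat m n" "X \<in> carrier_mat (n * l) r" "p < m" "b < l" "j < r"
  shows "(kron V (1\<^sub>m l) * X) $$ (p * l + b, j) = (\<Sum>i<n. V $$ (p, i) * X $$ (i * l + b, j))"
proof -
  have "(kron V (1\<^sub>m l) * X) $$ (p * l + b, j) =
      (\<Sum>i<n. \<Sum>c<l. kron V (1\<^sub>m l) $$ (p * l + b, i * l + c) * X $$ (i * l + c, j))"
    using assms by (subst mult_index) (auto simp: index_mult_less sum_lessThan_mult)
  also have "\<dots> = (\<Sum>i<n. \<Sum>c<l. (V $$ (p, i) * X $$ (i * l + c, j)) * of_bool (c = b))"
    using assms by (intro sum.cong) (auto simp: index_mult_less)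
  finally show ?thesis using assms by (simp only: sum_of_bool)
qed

text \<open>Used to pull the dilation \<open>V\<close> out of the trace over the environment of
  \<open>W\<close>, since \<open>V\<close> acts on the factor that is kept.\<close>

lemma ptrace_conj:
  assumes V: "V \<in> carrier_mat m n" and X: "X \<in> carrier_mat (n * l) (n * l)"
  shows "ptrace m l (kron V (1\<^sub>m l) * X * adj (kron V (1\<^sub>m l))) = V * ptrace n l X * adj V"
proof (rule eq_matI)
  fix p q assume "p < dim_row (V * ptrace n l X * adj V)" "q < dim_col (V * ptrace n l X * adj V)"
  then have pq: "p < m" "q < m" using assms by auto
  let ?K = "kron V (1\<^sub>m l)"
  have ent: "(?K * X * adj ?K) $$ (p * l + b, q * l + b) =
      (\<Sum>j<n. \<Sum>i<n. V $$ (p, i) * X $$ (i * l + b, j * l + b) * cnj (V $$ (q, j)))" if b: "b < l" for b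
  proof -
    \<comment> \<open>Taking adjoints turns the right factor into a left one, so that the entry
      formula \<open>kron_one_mult_index\<close> covers both sides.\<close>
    have "?K * X * adj ?K = adj (?K * adj (?K * X))"
      using assms by (simp add: adj_mult mult_assoc_dim)
    then have "(?K * X * adj ?K) $$ (p * l + b, q * l + b) = cnj ((?K * adj (?K * X)) $$ (q * l + b, p * l + b))"
      using assms pq b by (simp add: index_mult_less del: index_mult_mat(1))
    also have "\<dots> = cnj (\<Sum>j<n. V $$ (q, j) * adj (?K * X) $$ (j * l + b, p * l + b))"
      by (subst kron_one_mult_index[where m = m and n = n and r = "m * l"])
        (use assms pq b in \<open>auto simp: index_mult_less\<close>)
    also have "\<dots> = (\<Sum>j<n. cnj (V $$ (q, j)) * (?K * X) $$ (p * l + b, j * l + b))"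
      using assms pq b by (simp add: index_mult_less del: index_mult_mat(1))
    also have "\<dots> = (\<Sum>j<n. cnj (V $$ (q, j)) * (\<Sum>i<n. V $$ (p, i) * X $$ (i * l + b, j * l + b)))"
      using kron_one_mult_index[OF V X pq(1) b] b by (simp add: index_mult_less del: index_mult_mat(1))
    finally show ?thesis by (simp add: sum_distrib_left mult_ac)
  qed
  have "ptrace m l (?K * X * adj ?K) $$ (p, q) =
      (\<Sum>b<l. \<Sum>j<n. \<Sum>i<n. V $$ (p, i) * X $$ (i * l + b, j * l + b) * cnj (V $$ (q, j)))"
    using pq ent by simp
  also have "\<dots> = (\<Sum>j<n. \<Sum>i<n. \<Sum>b<l. V $$ (p, i) * X $$ (i * l + b, j * l + b) * cnj (V $$ (q, j)))"
    by (rule trans[OF sum.swap], rule sum.cong[OF refl], rule sum.swap)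
  also have "\<dots> = (V * ptrace n l X * adj V) $$ (p, q)"
    using pq V
    by (simp add: mult_index sum_distrib_left sum_distrib_right mult_adj_index del: index_mult_mat(1))
  finally show "ptrace m l (?K * X * adj ?K) $$ (p, q) = (V * ptrace n l X * adj V) $$ (p, q)" .
qed (use assms in auto)

lemma psd_ptrace:
  assumes "psd (n * d) X"
  shows "psd n (ptrace n d X)"
proof -
  obtain k G where G: "G \<in> carrier_mat (n * d) k" "X = G * adj G" using psd_Gram assms by blast
  \<comment> \<open>\<open>G\<close> with the traced index moved from the rows to the columns: the
    column sum in \<open>H * adj H\<close> then performs the partial trace as well.\<close>
  define H where "H = mat n (d * k) (\<lambda>(p, j). G $$ (p * d + j div k, j mod k))"
  have "ptrace n d X = H * adj H"
  proof (rule eq_matI)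
    fix p q assume "p < dim_row (H * adj H)" "q < dim_col (H * adj H)"
    then have pq: "p < n" "q < n" by (auto simp: H_def)
    have "(H * adj H) $$ (p, q) = (\<Sum>j<d * k. H $$ (p, j) * cnj (H $$ (q, j)))"
      using pq by (subst mult_adj_index) (auto simp: H_def)
    also have "\<dots> = (\<Sum>b<d. \<Sum>c<k. G $$ (p * d + b, c) * cnj (G $$ (q * d + b, c)))"
      using pq by (simp add: sum_lessThan_mult H_def index_mult_less)
    also have "\<dots> = ptrace n d X $$ (p, q)"
      using pq G by (simp add: mult_adj_index index_mult_less del: index_mult_mat(1))
    finally show "ptrace n d X $$ (p, q) = (H * adj H) $$ (p, q)" ..
  qed (auto simp: H_def)
  then show ?thesis using psd_mult_adj[of H n "d * k"] by (simp add: H_def)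
qed

text \<open>A vector with a pure marginal is a product. Reshaped as an m x d matrix
  \<open>Z\<close>, the vector has marginal \<open>Z * adj Z\<close>, which is the projection
  \<open>P\<close> onto \<psi>. So the complement \<open>Q\<close> annihilates \<open>Z\<close>,
  whence \<open>Z\<close> = \<psi> (\<open>adj \<psi> * Z\<close>), and the row
  \<open>adj \<psi> * Z\<close> lists the entries of \<open>c\<close>.\<close>

lemma ptrace_pure:
  assumes z: "z \<in> carrier_mat (m * d) 1" and \<psi>: "\<psi> \<in> carrier_mat m 1" "adj \<psi> * \<psi> = 1\<^sub>m 1"
    and eq: "ptrace m d (z * adj z) = \<psi> * adj \<psi>"
  obtains c where "c \<in> carrier_mat d 1" "z = kron \<psi> c"
proof -
  define Z where "Z = mat m d (\<lambda>(p, b). z $$ (p * d + b, 0))"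
  have Z: "Z \<in> carrier_mat m d" by (simp add: Z_def)
  have ZZ: "Z * adj Z = \<psi> * adj \<psi>"
  proof (rule eq_matI)
    fix p q assume "p < dim_row (\<psi> * adj \<psi>)" "q < dim_col (\<psi> * adj \<psi>)"
    then have pq: "p < m" "q < m" using \<psi> by auto
    have "(Z * adj Z) $$ (p, q) = ptrace m d (z * adj z) $$ (p, q)"
      using z pq by (auto simp: mult_adj_index Z_def index_mult_less simp del: index_mult_mat(1) intro!: sum.cong)
    then show "(Z * adj Z) $$ (p, q) = (\<psi> * adj \<psi>) $$ (p, q)" by (simp only: eq)
  qed (use \<psi> Z in auto)
  define P where "P = \<psi> * adj \<psi>"
  define Q where "Q = 1\<^sub>m m - P"
  have P: "P \<in> carrier_mat m m" using \<psi> by (auto simp: P_def)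
  have Q: "Q \<in> carrier_mat m m" using P by (auto simp: Q_def)
  have "P * P = \<psi> * ((adj \<psi> * \<psi>) * adj \<psi>)"
    using \<psi>(1) by (simp add: P_def mult_assoc_dim)
  also have "\<dots> = P" using \<psi> by (simp only: P_def) (simp add: one_mult_dim)
  finally have QP: "Q * P = 0\<^sub>m m m" using P by (simp add: Q_def diff_mult_dim one_mult_dim)
  have "(Q * Z) * adj (Q * Z) = Q * (Z * adj Z) * adj Q"
    using Q Z by (simp add: adj_mult mult_assoc_dim)
  also have "\<dots> = 0\<^sub>m m m" using ZZ QP Q by (simp add: left_mult_zero_mat[of _ m m] flip: P_def)
  finally have QZ: "Q * Z = 0\<^sub>m m d"
    using mtrace_mult_adj_eq_0[of "Q * Z"] Q Z by (simp add: mtrace_def)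
  have "Z = (P + Q) * Z"
  proof -
    have "P + Q = 1\<^sub>m m" by (rule eq_matI) (use P in \<open>auto simp: Q_def\<close>)
    then show ?thesis using Z by (simp add: one_mult_dim)
  qed
  also have "\<dots> = P * Z + Q * Z" using P Q Z by (simp add: add_mult_dim)
  also have "\<dots> = P * Z" unfolding QZ by (rule right_add_zero_mat[of _ m d]) (use P Z in auto)
  also have "\<dots> = \<psi> * (adj \<psi> * Z)" using Z \<psi> by (simp add: P_def mult_assoc_dim)
  finally have Zeq: "Z = \<psi> * (adj \<psi> * Z)" .
  define c where "c = mat d 1 (\<lambda>(b, _::nat). (adj \<psi> * Z) $$ (0, b))"
  have "z = kron \<psi> c"
  proof (rule eq_matI)
    fix i j assume "i < dim_row (kron \<psi> c)" "j < dim_col (kron \<psi> c)"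
    then have ij: "i < m * d" "j = 0" using \<psi> by (auto simp: c_def)
    have "z $$ (i, 0) = Z $$ (i div d, i mod d)"
      using ij by (simp add: Z_def div_mod_less)
    also have "\<dots> = (\<psi> * (adj \<psi> * Z)) $$ (i div d, i mod d)" using Zeq by simp
    also have "\<dots> = \<psi> $$ (i div d, 0) * (adj \<psi> * Z) $$ (0, i mod d)"
      using \<psi> Z ij by (subst mult_index) (auto simp: div_mod_less)
    finally show "z $$ (i, j) = kron \<psi> c $$ (i, j)"
      using ij \<psi> by (simp add: c_def div_mod_less)
  qed (use z \<psi> in \<open>auto simp: c_def\<close>)
  moreover have "c \<in> carrier_mat d 1" by (simp add: c_def)
  ultimately show ?thesis by (metis that)
qed

subsection \<open>Completely positive maps\<close>

text \<open>Separated from trace preservation because a channel is assembled below from summands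
  such as compression by a projection, which need not preserve the trace.\<close>

definition cp_map :: "nat \<Rightarrow> nat \<Rightarrow> (complex mat \<Rightarrow> complex mat) \<Rightarrow> bool" where
  "cp_map n m \<Lambda> \<longleftrightarrow>
     (\<forall>X \<in> carrier_mat n n. \<Lambda> X \<in> carrier_mat m m) \<and>
     (\<forall>X \<in> carrier_mat n n. \<forall>Y \<in> carrier_mat n n. \<Lambda> (X + Y) = \<Lambda> X + \<Lambda> Y) \<and>
     (\<forall>c. \<forall>X \<in> carrier_mat n n. \<Lambda> (c \<cdot>\<^sub>m X) = c \<cdot>\<^sub>m \<Lambda> X) \<and>
     (\<forall>k X. psd (k * n) X \<longrightarrow> psd (k * m) (lift k n m \<Lambda> X))"

lemma cptp_iff: "cptp n m \<Lambda> \<longleftrightarrow> cp_map n m \<Lambda> \<and> (\<forall>X \<in> carrier_mat n n. mtrace (\<Lambda> X) = mtrace X)"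
  by (auto simp: cptp_def cp_map_def)

lemma cp_map_carrier: "cp_map n m \<Lambda> \<Longrightarrow> X \<in> carrier_mat n n \<Longrightarrow> \<Lambda> X \<in> carrier_mat m m"
  by (simp add: cp_map_def)

lemma dim_blk [simp]: "dim_row (blk n a b X) = n" "dim_col (blk n a b X) = n"
  by (simp_all add: blk_def)

lemma blk_carrier [simp]: "blk n a b X \<in> carrier_mat n n"
  by (simp add: blk_def)

lemma blk_lift:
  assumes "cp_map n m \<Lambda>" "a < k" "b < k"
  shows "blk m a b (lift k n m \<Lambda> X) = \<Lambda> (blk n a b X)"
proof -
  have "\<Lambda> (blk n a b X) \<in> carrier_mat m m" using assms cp_map_carrier by simp
  then show ?thesis
    by (intro eq_matI) (use assms in \<open>auto simp: blk_def[of m] lift_def index_mult_less\<close>)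
qed

text \<open>Lifting respects composition: by \<open>blk_lift\<close> the blocks of a lifted matrix
  are the images of the blocks.\<close>

lemma cp_map_comp:
  assumes "cp_map n m \<Lambda>" "cp_map m l \<Lambda>'"
  shows "cp_map n l (\<lambda>X. \<Lambda>' (\<Lambda> X))"
proof -
  have "psd (k * l) (lift k n l (\<lambda>X. \<Lambda>' (\<Lambda> X)) X)" if "psd (k * n) X" for k X
  proof -
    have "lift k n l (\<lambda>X. \<Lambda>' (\<Lambda> X)) X = lift k m l \<Lambda>' (lift k n m \<Lambda> X)"
      unfolding lift_def[of _ _ l]
      by (rule eq_matI) (auto simp: blk_lift[OF assms(1)] div_mod_less)
    then show ?thesis using assms that by (auto simp: cp_map_def)
  qed
  then show ?thesis using assms by (auto simp: cp_map_def)
qed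

lemma cptp_comp: "cptp n m \<Lambda> \<Longrightarrow> cptp m l \<Lambda>' \<Longrightarrow> cptp n l (\<lambda>X. \<Lambda>' (\<Lambda> X))"
  using cp_map_comp by (auto simp: cptp_iff cp_map_carrier)

lemma cp_map_add:
  assumes "cp_map n m \<Lambda>" "cp_map n m \<Lambda>'"
  shows "cp_map n m (\<lambda>X. \<Lambda> X + \<Lambda>' X)"
proof -
  note c = cp_map_carrier[OF assms(1)] cp_map_carrier[OF assms(2)]
  have "\<Lambda> (X + Y) + \<Lambda>' (X + Y) = (\<Lambda> X + \<Lambda>' X) + (\<Lambda> Y + \<Lambda>' Y)"
    if "X \<in> carrier_mat n n" "Y \<in> carrier_mat n n" for X Y
  proof -
    have "\<Lambda> (X + Y) + \<Lambda>' (X + Y) = (\<Lambda> X + \<Lambda> Y) + (\<Lambda>' X + \<Lambda>' Y)"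
      using assms that by (simp add: cp_map_def)
    also have "\<dots> = (\<Lambda> X + \<Lambda>' X) + (\<Lambda> Y + \<Lambda>' Y)"
      using c[OF that(1)] c[OF that(2)] by (intro eq_matI) auto
    finally show ?thesis .
  qed
  moreover have "\<Lambda> (c \<cdot>\<^sub>m X) + \<Lambda>' (c \<cdot>\<^sub>m X) = c \<cdot>\<^sub>m (\<Lambda> X + \<Lambda>' X)" if "X \<in> carrier_mat n n" for c X
  proof -
    have "\<Lambda> (c \<cdot>\<^sub>m X) + \<Lambda>' (c \<cdot>\<^sub>m X) = c \<cdot>\<^sub>m \<Lambda> X + c \<cdot>\<^sub>m \<Lambda>' X"
      using assms that by (simp add: cp_map_def)
    also have "\<dots> = c \<cdot>\<^sub>m (\<Lambda> X + \<Lambda>' X)"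
      using c[OF that] by (intro eq_matI) (auto simp: distrib_left)
    finally show ?thesis .
  qed
  moreover have "psd (k * m) (lift k n m (\<lambda>X. \<Lambda> X + \<Lambda>' X) X)" if "psd (k * n) X" for k X
  proof -
    have "(\<Lambda> (blk n a b X) + \<Lambda>' (blk n a b X)) $$ (i, j) =
        \<Lambda> (blk n a b X) $$ (i, j) + \<Lambda>' (blk n a b X) $$ (i, j)" if "i < m" "j < m" for a b i j
      using c[of "blk n a b X"] that by auto
    then have "lift k n m (\<lambda>X. \<Lambda> X + \<Lambda>' X) X = lift k n m \<Lambda> X + lift k n m \<Lambda>' X"
      by (intro eq_matI) (auto simp: lift_def div_mod_less)
    then show ?thesis using psd_add assms that by (simp add: cp_map_def)
  qed
  ultimately show ?thesis using c by (auto simp: cp_map_def)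
qed

lemma cp_map_conj:
  assumes V: "V \<in> carrier_mat m n"
  shows "cp_map n m (\<lambda>X. V * X * adj V)"
proof -
  have "psd (k * m) (lift k n m (\<lambda>X. V * X * adj V) X)" if X: "psd (k * n) X" for k X
  proof -
    obtain r G where G: "G \<in> carrier_mat (k * n) r" "X = G * adj G" using psd_Gram X by blast
    \<comment> \<open>The block rows of \<open>G\<close>. Block (a, b) of \<open>X\<close> is
      \<open>B a * adj (B b)\<close>, so stacking the products \<open>V * B a\<close> into
      \<open>H\<close> gives a Gram factor of the lifted matrix.\<close>
    define B where "B a = mat n r (\<lambda>(q, c). G $$ (a * n + q, c))" for a
    have B: "B a \<in> carrier_mat n r" for a by (simp add: B_def)
    have blk: "blk n a b X = B a * adj (B b)" if "a < k" "b < k" for a b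
      by (rule eq_matI) (use that G in \<open>auto simp: mult_adj_index B_def blk_def index_mult_less
        simp del: index_mult_mat(1)\<close>)
    define H where "H = mat (k * m) r (\<lambda>(i, c). (V * B (i div m)) $$ (i mod m, c))"
    have "lift k n m (\<lambda>X. V * X * adj V) X = H * adj H"
    proof (rule eq_matI)
      fix i j assume "i < dim_row (H * adj H)" "j < dim_col (H * adj H)"
      then have ij: "i < k * m" "j < k * m" by (auto simp: H_def)
      let ?a = "i div m" and ?b = "j div m"
      have "lift k n m (\<lambda>X. V * X * adj V) X $$ (i, j) = (V * (B ?a * adj (B ?b)) * adj V) $$ (i mod m, j mod m)"
        using ij by (simp add: lift_def blk div_mod_less del: index_mult_mat(1))
      also have "V * (B ?a * adj (B ?b)) * adj V = (V * B ?a) * adj (V * B ?b)"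
        using V B[of ?a] B[of ?b] by (simp add: mult_assoc_dim adj_mult)
      also have "\<dots> $$ (i mod m, j mod m) = (H * adj H) $$ (i, j)"
        using ij V B[of ?a] B[of ?b]
        by (simp add: mult_adj_index H_def div_mod_less del: index_mult_mat(1))
      finally show "lift k n m (\<lambda>X. V * X * adj V) X $$ (i, j) = (H * adj H) $$ (i, j)" .
    qed (auto simp: lift_def H_def)
    then show ?thesis using psd_mult_adj[of H "k * m" r] by (simp add: H_def)
  qed
  moreover have "V * (X + Y) * adj V = V * X * adj V + V * Y * adj V"
    if "X \<in> carrier_mat n n" "Y \<in> carrier_mat n n" for X Y
    using that V by (simp add: mult_add_dim add_mult_dim)
  moreover have "V * (c \<cdot>\<^sub>m X) * adj V = c \<cdot>\<^sub>m (V * X * adj V)" if "X \<in> carrier_mat n n" for c X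
    using that V by (simp add: smult_mult_dim mult_smult_dim)
  ultimately show ?thesis using V by (auto simp: cp_map_def)
qed

lemma cptp_conj:
  assumes "V \<in> carrier_mat m n" "adj V * V = 1\<^sub>m n"
  shows "cptp n m (\<lambda>X. V * X * adj V)"
  using cp_map_conj mtrace_conj assms by (auto simp: cptp_iff)

text \<open>A two-outcome measurement with Kraus operators \<open>A\<close> and \<open>B\<close>,
  followed by a channel chosen by the outcome. The completeness relation and cyclicity of the trace
  give trace preservation.\<close>

lemma cptp_sum2:
  assumes \<Phi>: "cptp a m \<Phi>" "cptp b m \<Phi>'"
    and AB: "A \<in> carrier_mat a n" "B \<in> carrier_mat b n" "adj A * A + adj B * B = 1\<^sub>m n"
  shows "cptp n m (\<lambda>X. \<Phi> (A * X * adj A) + \<Phi>' (B * X * adj B))"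
proof -
  have "mtrace (\<Phi> (A * X * adj A) + \<Phi>' (B * X * adj B)) = mtrace X" if X: "X \<in> carrier_mat n n" for X
  proof -
    have c: "A * X * adj A \<in> carrier_mat a a" "B * X * adj B \<in> carrier_mat b b" using AB X by auto
    have c': "\<Phi> (A * X * adj A) \<in> carrier_mat m m" "\<Phi>' (B * X * adj B) \<in> carrier_mat m m"
      using \<Phi> c by (auto simp: cptp_iff cp_map_carrier)
    have "mtrace (\<Phi> (A * X * adj A) + \<Phi>' (B * X * adj B)) = mtrace (A * X * adj A) + mtrace (B * X * adj B)"
      using \<Phi> c c' by (simp add: mtrace_add cptp_iff)
    also have "mtrace (A * X * adj A) = mtrace (adj A * A * X)"
      using AB X mtrace_comm[of "A * X" "adj A"] by (simp add: mult_assoc_dim)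
    also have "mtrace (B * X * adj B) = mtrace (adj B * B * X)"
      using AB X mtrace_comm[of "B * X" "adj B"] by (simp add: mult_assoc_dim)
    also have "mtrace (adj A * A * X) + mtrace (adj B * B * X) = mtrace ((adj A * A + adj B * B) * X)"
      using AB(1,2) X by (simp add: add_mult_dim mtrace_add)
    finally show ?thesis using AB X by (simp add: one_mult_dim)
  qed
  moreover have "cp_map n m (\<lambda>X. \<Phi> (A * X * adj A) + \<Phi>' (B * X * adj B))"
    using \<Phi> AB(1,2) by (intro cp_map_add cp_map_comp[OF cp_map_conj]) (auto simp: cptp_iff)
  ultimately show ?thesis by (simp add: cptp_iff)
qed

text \<open>The lifted map is again a partial trace, on a larger kept space, because both sides read
  the same entry of a triple index; complete positivity is then plain positivity. Attaching a state,
  in \<open>cptp_kron\<close>, is treated alike.\<close>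

lemma cptp_ptrace: "cptp (n * d) n (ptrace n d)"
proof -
  have "psd (k * n) (lift k (n * d) n (ptrace n d) X)" if X: "psd (k * (n * d)) X" for k X
  proof -
    have "lift k (n * d) n (ptrace n d) X = ptrace (k * n) d X"
    proof (rule eq_matI)
      fix i j assume "i < dim_row (ptrace (k * n) d X)" "j < dim_col (ptrace (k * n) d X)"
      then have ij: "i < k * n" "j < k * n" by auto
      have idx: "i div n * (n * d) + (i mod n * d + b) = i * d + b" for i b
      proof -
        have "i div n * (n * d) + (i mod n * d + b) = (i div n * n + i mod n) * d + b"
          by (simp only: distrib_right mult.assoc add.assoc)
        then show ?thesis by simp
      qed
      show "lift k (n * d) n (ptrace n d) X $$ (i, j) = ptrace (k * n) d X $$ (i, j)"
        using ij by (simp add: lift_def blk_def div_mod_less index_mult_less idx)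
    qed (auto simp: lift_def)
    then show ?thesis using psd_ptrace[of "k * n" d X] X by (simp add: mult.assoc)
  qed
  moreover have "ptrace n d (X + Y) = ptrace n d X + ptrace n d Y"
    if "X \<in> carrier_mat (n * d) (n * d)" "Y \<in> carrier_mat (n * d) (n * d)" for X Y
    by (rule eq_matI) (use that in \<open>auto simp: index_mult_less sum.distrib\<close>)
  moreover have "ptrace n d (c \<cdot>\<^sub>m X) = c \<cdot>\<^sub>m ptrace n d X"
    if "X \<in> carrier_mat (n * d) (n * d)" for c X
    by (rule eq_matI) (use that in \<open>auto simp: index_mult_less sum_distrib_left\<close>)
  ultimately show ?thesis by (auto simp: cptp_def mtrace_ptrace)
qed

lemma cptp_kron:
  assumes "density d \<omega>"
  shows "cptp n (n * d) (\<lambda>X. kron X \<omega>)"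
proof -
  have \<omega>: "\<omega> \<in> carrier_mat d d" using assms psd_carrier by (auto simp: density_def)
  have "psd (k * (n * d)) (lift k n (n * d) (\<lambda>X. kron X \<omega>) X)" if X: "psd (k * n) X" for k X
  proof -
    have Xc: "X \<in> carrier_mat (k * n) (k * n)" using X psd_carrier by auto
    have "lift k n (n * d) (\<lambda>X. kron X \<omega>) X = kron X \<omega>"
    proof (rule eq_matI)
      fix i j assume "i < dim_row (kron X \<omega>)" "j < dim_col (kron X \<omega>)"
      then have ij: "i < k * n * d" "j < k * n * d" "i < k * (n * d)" "j < k * (n * d)"
        using Xc \<omega> by (auto simp: mult.assoc)
      have idx: "i div (n * d) * n + i mod (n * d) div d = i div d" for i
        by (simp add: div_mult_div mod_mult_div)
      show "lift k n (n * d) (\<lambda>X. kron X \<omega>) X $$ (i, j) = kron X \<omega> $$ (i, j)"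
        using ij(1,2) div_mod_less[OF ij(3)] div_mod_less[OF ij(4)] Xc \<omega> 
        by (simp add: lift_def blk_def ij(3,4) div_mod_less mod_mult_mod idx)
    qed (use Xc \<omega> in \<open>auto simp: lift_def mult.assoc\<close>)
    then show ?thesis using psd_kron[OF X, of d \<omega>] assms by (simp add: density_def mult.assoc)
  qed
  then show ?thesis
    using assms \<omega> by (auto simp: cptp_def kron_add_left kron_smult_left density_def mtrace_kron[of _ n \<omega> d])
qed

subsection \<open>Stinespring dilations\<close>

definition elem_mat :: "nat \<Rightarrow> nat \<Rightarrow> nat \<Rightarrow> complex mat" where
  "elem_mat n i j = mat n n (\<lambda>(p, q). of_bool (p = i) * of_bool (q = j))"

lemma elem_mat_carrier [simp]: "elem_mat n i j \<in> carrier_mat n n"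
  by (simp add: elem_mat_def)

lemma dim_elem_mat [simp]: "dim_row (elem_mat n i j) = n" "dim_col (elem_mat n i j) = n"
  by (simp_all add: elem_mat_def)

lemma mtrace_elem_mat: "i < n \<Longrightarrow> mtrace (elem_mat n i j) = of_bool (i = j)"
  by (simp add: mtrace_def elem_mat_def sum_of_bool)

lemma mtrace_mult_elem_mat:
  assumes "A \<in> carrier_mat n n" "i < n" "j < n"
  shows "mtrace (A * elem_mat n i j) = A $$ (j, i)"
proof -
  have "mtrace (A * elem_mat n i j) = (\<Sum>p<n. \<Sum>k<n. A $$ (p, k) * elem_mat n i j $$ (k, p))"
    by (rule mtrace_mult) (use assms in auto)
  also have "\<dots> = (\<Sum>p<n. \<Sum>k<n. (A $$ (p, k) * of_bool (p = j)) * of_bool (k = i))"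
    by (intro sum.cong) (auto simp: elem_mat_def)
  also have "\<dots> = A $$ (j, i)" using assms by (simp only: sum_of_bool)
  finally show ?thesis .
qed

lemma cp_map_expand:
  assumes "cp_map n m \<Lambda>" "X \<in> carrier_mat n n" "p < m" "q < m"
  shows "\<Lambda> X $$ (p, q) = (\<Sum>i<n. \<Sum>j<n. X $$ (i, j) * \<Lambda> (elem_mat n i j) $$ (p, q))"
proof -
  \<comment> \<open>\<open>X\<close> with the entries outside \<open>S\<close> set to zero. Growing
    \<open>S\<close> by one index pair adds one multiple of a matrix unit, so additivity and
    homogeneity suffice.\<close>
  define R where "R S = mat n n (\<lambda>ij. of_bool (ij \<in> S) * X $$ ij)" for S
  have R: "R S \<in> carrier_mat n n" for S by (simp add: R_def)
  have *: "\<Lambda> (R S) $$ (p, q) = (\<Sum>(i, j)\<in>S. X $$ (i, j) * \<Lambda> (elem_mat n i j) $$ (p, q))"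
    if "finite S" "S \<subseteq> {..<n} \<times> {..<n}" for S
    using that
  proof (induction S)
    case empty
    have "R {} = 0 \<cdot>\<^sub>m R {}" by (rule eq_matI) (auto simp: R_def)
    then have "\<Lambda> (R {}) = 0 \<cdot>\<^sub>m \<Lambda> (R {})" using assms(1) R by (metis cp_map_def)
    then have "\<Lambda> (R {}) $$ (p, q) = (0 \<cdot>\<^sub>m \<Lambda> (R {})) $$ (p, q)" by (rule arg_cong)
    also have "\<dots> = 0" using assms(3,4) cp_map_carrier[OF assms(1) R, of "{}"] by auto
    finally show ?case by simp
  next
    case (insert ij S)
    obtain i j where ij: "ij = (i, j)" "i < n" "j < n" using insert by (cases ij) auto
    have "R (insert ij S) = R S + X $$ (i, j) \<cdot>\<^sub>m elem_mat n i j"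
      by (rule eq_matI) (use insert.hyps ij in \<open>auto simp: R_def elem_mat_def\<close>)
    then have "\<Lambda> (R (insert ij S)) = \<Lambda> (R S) + X $$ (i, j) \<cdot>\<^sub>m \<Lambda> (elem_mat n i j)"
      using assms(1) R by (simp add: cp_map_def)
    then have "\<Lambda> (R (insert ij S)) $$ (p, q) = \<Lambda> (R S) $$ (p, q) + X $$ (i, j) * \<Lambda> (elem_mat n i j) $$ (p, q)"
      using assms(3,4) carrier_matD[OF cp_map_carrier[OF assms(1) elem_mat_carrier[of n i j]]] by simp
    then show ?case using insert ij by (simp add: add.commute)
  qed
  have "R ({..<n} \<times> {..<n}) = X" by (rule eq_matI) (use assms in \<open>auto simp: R_def\<close>)
  then show ?thesis using *[of "{..<n} \<times> {..<n}"] by (simp add: sum.cartesian_product)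
qed

text \<open>A Gram factor of the Choi matrix supplies Kraus operators, and stacking them gives
  \<open>V\<close>. Trace preservation, tested on matrix units, says precisely that \<open>V\<close>
  is an isometry.\<close>

lemma cptp_Stinespring:
  assumes "cptp n m \<Lambda>"
  obtains k V where "V \<in> carrier_mat (m * k) n" "adj V * V = 1\<^sub>m n"
    "\<And>X. X \<in> carrier_mat n n \<Longrightarrow> \<Lambda> X = ptrace m k (V * X * adj V)"
proof -
  have cp: "cp_map n m \<Lambda>" using assms by (simp add: cptp_iff)
  \<comment> \<open>The unnormalised maximally entangled vector, the sum of all e_i \<otimes> e_i.
    The blocks of \<open>\<Omega> * adj \<Omega>\<close> are the matrix units, so lifting yields the
    Choi matrix of \<Lambda>.\<close>
  define \<Omega> where "\<Omega> = mat (n * n) 1 (\<lambda>(x, _::nat). of_bool (x div n = x mod n) :: complex)"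
  have \<Omega>: "\<Omega> \<in> carrier_mat (n * n) 1" by (simp add: \<Omega>_def)
  have blk: "blk n i j (\<Omega> * adj \<Omega>) = elem_mat n i j" if "i < n" "j < n" for i j
    by (rule eq_matI) (use that in \<open>auto simp: blk_def elem_mat_def \<Omega>_def mult_adj_index index_mult_less
      simp del: index_mult_mat(1)\<close>)
  have "psd (n * m) (lift n n m \<Lambda> (\<Omega> * adj \<Omega>))"
    using cp psd_mult_adj[OF \<Omega>] by (simp add: cp_map_def)
  then obtain k G where G: "G \<in> carrier_mat (n * m) k" "lift n n m \<Lambda> (\<Omega> * adj \<Omega>) = G * adj G"
    using psd_Gram by blast
  have el: "\<Lambda> (elem_mat n i j) $$ (p, q) = (\<Sum>a<k. G $$ (i * m + p, a) * cnj (G $$ (j * m + q, a)))"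
    if "i < n" "j < n" "p < m" "q < m" for i j p q
  proof -
    have "\<Lambda> (elem_mat n i j) $$ (p, q) = lift n n m \<Lambda> (\<Omega> * adj \<Omega>) $$ (i * m + p, j * m + q)"
      using that by (simp add: lift_def index_mult_less blk)
    also have "\<dots> = (\<Sum>a<k. G $$ (i * m + p, a) * cnj (G $$ (j * m + q, a)))"
      using that G by (simp add: mult_adj_index index_mult_less del: index_mult_mat(1))
    finally show ?thesis .
  qed
  \<comment> \<open>Column a of \<open>G\<close> holds the a-th Kraus operator, with entry (p, i)
    stored at \<open>i * m + p\<close>. In \<open>V\<close> the number a of the operator becomes the
    environment index, which is the minor one.\<close>
  define V where "V = mat (m * k) n (\<lambda>(x, i). G $$ (i * m + x div k, x mod k))"
  have V: "V \<in> carrier_mat (m * k) n" by (simp add: V_def)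
  have \<Lambda>: "\<Lambda> X = ptrace m k (V * X * adj V)" if X: "X \<in> carrier_mat n n" for X
  proof (rule eq_matI)
    fix p q assume "p < dim_row (ptrace m k (V * X * adj V))" "q < dim_col (ptrace m k (V * X * adj V))"
    then have pq: "p < m" "q < m" by auto
    have ent: "(V * X * adj V) $$ (p * k + a, q * k + a) =
        (\<Sum>j<n. \<Sum>i<n. X $$ (i, j) * (G $$ (i * m + p, a) * cnj (G $$ (j * m + q, a))))" if "a < k" for a
    proof -
      have Vx: "V $$ (p * k + a, i) = G $$ (i * m + p, a)" "V $$ (q * k + a, i) = G $$ (i * m + q, a)"
        if "i < n" for i
        using pq \<open>a < k\<close> that by (simp_all add: V_def index_mult_less)
      have "(V * X * adj V) $$ (p * k + a, q * k + a) =
          (\<Sum>j<n. (\<Sum>i<n. V $$ (p * k + a, i) * X $$ (i, j)) * cnj (V $$ (q * k + a, j)))"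
        using pq V X that by (simp add: mult_adj_index mult_index index_mult_less del: index_mult_mat(1))
      also have "\<dots> = (\<Sum>j<n. \<Sum>i<n. X $$ (i, j) * (G $$ (i * m + p, a) * cnj (G $$ (j * m + q, a))))"
        unfolding sum_distrib_right by (intro sum.cong) (auto simp: Vx)
      finally show ?thesis .
    qed
    have "ptrace m k (V * X * adj V) $$ (p, q) =
        (\<Sum>a<k. \<Sum>j<n. \<Sum>i<n. X $$ (i, j) * (G $$ (i * m + p, a) * cnj (G $$ (j * m + q, a))))"
      using pq ent by simp
    also have "\<dots> = (\<Sum>j<n. \<Sum>i<n. \<Sum>a<k. X $$ (i, j) * (G $$ (i * m + p, a) * cnj (G $$ (j * m + q, a))))"
      by (rule trans[OF sum.swap], rule sum.cong[OF refl], rule sum.swap)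
    also have "\<dots> = (\<Sum>j<n. \<Sum>i<n. X $$ (i, j) * \<Lambda> (elem_mat n i j) $$ (p, q))"
      by (intro sum.cong refl) (use pq in \<open>simp add: el sum_distrib_left\<close>)
    also have "\<dots> = (\<Sum>i<n. \<Sum>j<n. X $$ (i, j) * \<Lambda> (elem_mat n i j) $$ (p, q))"
      by (rule sum.swap)
    also have "\<dots> = \<Lambda> X $$ (p, q)" by (rule cp_map_expand[OF cp X pq, symmetric])
    finally show "\<Lambda> X $$ (p, q) = ptrace m k (V * X * adj V) $$ (p, q)" ..
  qed (use cp_map_carrier[OF cp X] in auto)
  have "adj V * V = 1\<^sub>m n"
  proof (rule eq_matI)
    fix i j assume "i < dim_row (1\<^sub>m n :: complex mat)" "j < dim_col (1\<^sub>m n :: complex mat)"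
    then have ij: "i < n" "j < n" by auto
    let ?E = "elem_mat n j i"
    have "(adj V * V) $$ (i, j) = mtrace (adj V * V * ?E)"
      by (rule mtrace_mult_elem_mat[symmetric]) (use V ij in auto)
    also have "\<dots> = mtrace (V * ?E * adj V)"
      using V mtrace_comm[of "V * ?E" "adj V"] by (auto simp: mult_assoc_dim)
    also have "\<dots> = mtrace (\<Lambda> ?E)"
      using V by (subst \<Lambda>) (auto intro!: mtrace_ptrace[symmetric])
    also have "\<dots> = of_bool (j = i)"
      using assms ij by (simp add: cptp_iff mtrace_elem_mat)
    finally show "(adj V * V) $$ (i, j) = 1\<^sub>m n $$ (i, j)" using ij by auto
  qed (use V in auto)
  then show ?thesis using that V \<Lambda> by blast
qed

subsection \<open>Orthonormal families\<close>

text \<open>The complement 1 - \<open>V * adj V\<close> equals its product with its own adjoint, so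
  its trace n - r is nonnegative.\<close>

lemma isometry_dim_le:
  assumes "V \<in> carrier_mat n r" "adj V * V = 1\<^sub>m r"
  shows "r \<le> n"
proof -
  let ?P = "V * adj V" and ?Q = "1\<^sub>m n - V * adj V"
  have "?P * ?P = V * ((adj V * V) * adj V)" using assms(1) by (simp add: mult_assoc_dim)
  then have PP: "?P * ?P = ?P" using assms by (simp add: one_mult_dim)
  have Q: "?Q * adj ?Q = ?Q"
  proof -
    have "?Q * adj ?Q = ?Q - ?Q * ?P"
      using assms(1) by (simp add: adj_diff adj_mult mult_diff_dim mult_one_dim)
    also have "?Q * ?P = 0\<^sub>m n n"
      using assms(1) PP by (simp add: diff_mult_dim one_mult_dim)
    finally show ?thesis using assms(1) by simp
  qed
  have "0 \<le> mtrace ?Q" using mtrace_mult_adj_nonneg[of ?Q] by (simp only: Q)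
  also have "mtrace ?Q = of_nat n - mtrace ?P"
    using assms(1) by (simp add: mtrace_def sum_subtractf)
  also have "mtrace ?P = mtrace (adj V * V)" using assms(1) by (simp add: mtrace_comm)
  also have "\<dots> = of_nat r" using assms by (simp add: mtrace_def)
  finally show ?thesis by (simp add: less_eq_complex_def)
qed

lemma adj_mult_index:
  assumes "i < dim_col A" "j < dim_col B" "dim_row A = dim_row B"
  shows "(adj A * B) $$ (i, j) = (\<Sum>k<dim_row A. cnj (A $$ (k, i)) * B $$ (k, j))"
  using assms by (simp add: mult_index del: index_mult_mat(1))

lemma adj_mult_eq_0_comm:
  assumes "dim_row A = dim_row B" "adj A * B = 0\<^sub>m (dim_col A) (dim_col B)"
  shows "adj B * A = 0\<^sub>m (dim_col B) (dim_col A)"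
proof -
  have "adj B * A = adj (adj A * B)" using assms(1) by (simp add: adj_mult)
  then show ?thesis using assms by simp
qed

lemma append_col_isometry:
  assumes V: "V \<in> carrier_mat n r" "adj V * V = 1\<^sub>m r"
    and w: "w \<in> carrier_mat n 1" "adj w * w = 1\<^sub>m 1"
    and Vw: "adj V * w = 0\<^sub>m r 1"
  shows "adj (append_col V w) * append_col V w = 1\<^sub>m (Suc r)"
proof (rule eq_matI)
  fix i j assume "i < dim_row (1\<^sub>m (Suc r) :: complex mat)" "j < dim_col (1\<^sub>m (Suc r) :: complex mat)"
  then have ij: "i \<le> r" "j \<le> r" by auto
  have wV: "adj w * V = 0\<^sub>m 1 r" using adj_mult_eq_0_comm[of V w] V w Vw by simp
  have a: "append_col V w $$ (k, j) = (if j < r then V $$ (k, j) else w $$ (k, 0))"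
    if "k < n" "j \<le> r" for k j
    using that V by (auto simp: append_col_def)
  have "(adj (append_col V w) * append_col V w) $$ (i, j) =
      (if i < r then if j < r then (adj V * V) $$ (i, j) else (adj V * w) $$ (i, 0)
       else if j < r then (adj w * V) $$ (0, j) else (adj w * w) $$ (0, 0))"
    using ij V(1) w(1) append_col_carrier[OF V(1), of w]
    by (simp add: adj_mult_index a del: index_mult_mat(1))
  then show "(adj (append_col V w) * append_col V w) $$ (i, j) = 1\<^sub>m (Suc r) $$ (i, j)"
    unfolding V(2) w(2) Vw wV using ij by auto
qed (use append_col_carrier[OF V(1), of w] in auto)

lemma append_col_adj_mult_eq_0:
  assumes V: "V \<in> carrier_mat n r" "w \<in> carrier_mat n 1" "X \<in> carrier_mat n s"
    and 0: "adj V * X = 0\<^sub>m r s" "adj w * X = 0\<^sub>m 1 s"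
  shows "adj (append_col V w) * X = 0\<^sub>m (Suc r) s"
proof (rule eq_matI)
  fix i j assume "i < dim_row (0\<^sub>m (Suc r) s :: complex mat)" "j < dim_col (0\<^sub>m (Suc r) s :: complex mat)"
  then have ij: "i \<le> r" "j < s" by auto
  have "(adj (append_col V w) * X) $$ (i, j) = (if i < r then (adj V * X) $$ (i, j) else (adj w * X) $$ (0, j))"
    using ij V append_col_carrier[OF V(1), of w]
    by (simp add: adj_mult_index append_col_def del: index_mult_mat(1))
  then show "(adj (append_col V w) * X) $$ (i, j) = 0\<^sub>m (Suc r) s $$ (i, j)"
    unfolding 0 using ij by auto
qed (use V append_col_carrier[OF V(1), of w] in auto)

text \<open>Some column k of \<open>D\<close> is nonzero; \<open>e\<close> is the k-th basis vector
  divided by the norm of that column. The lemma supplies unit vectors inside the range of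
  \<open>D\<close>.\<close>

lemma nonzero_mat_unit_vector:
  assumes D: "D \<in> carrier_mat n m" "D \<noteq> 0\<^sub>m n m"
  obtains e where "e \<in> carrier_mat m 1" "adj (D * e) * (D * e) = 1\<^sub>m 1"
proof -
  obtain i k where ik: "i < n" "k < m" "D $$ (i, k) \<noteq> 0"
    using D by (metis eq_matI carrier_matD index_zero_mat)
  define s where "s = (\<Sum>p<n. (cmod (D $$ (p, k)))\<^sup>2)"
  have "(cmod (D $$ (i, k)))\<^sup>2 \<le> s"
    unfolding s_def by (rule member_le_sum) (use ik in auto)
  then have s: "s > 0" using ik by (smt (verit) norm_le_zero_iff zero_less_power)
  define e where "e = mat m 1 (\<lambda>(q, _::nat). complex_of_real (1 / sqrt s) * of_bool (q = k))"
  have e: "e \<in> carrier_mat m 1" by (simp add: e_def)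
  have De: "(D * e) $$ (p, 0) = D $$ (p, k) * complex_of_real (1 / sqrt s)" if "p < n" for p
  proof -
    have "(D * e) $$ (p, 0) = (\<Sum>q<m. D $$ (p, q) * e $$ (q, 0))"
      using D e that by (simp add: mult_index del: index_mult_mat(1))
    also have "\<dots> = (\<Sum>q<m. (D $$ (p, q) * complex_of_real (1 / sqrt s)) * of_bool (q = k))"
      by (intro sum.cong) (auto simp: e_def)
    finally show ?thesis using ik by (simp only: sum_of_bool)
  qed
  have "(adj (D * e) * (D * e)) $$ (0, 0) = (\<Sum>p<n. cnj ((D * e) $$ (p, 0)) * (D * e) $$ (p, 0))"
    using D e by (simp add: adj_mult_index del: index_mult_mat(1))
  also have "\<dots> = (\<Sum>p<n. complex_of_real ((cmod (D $$ (p, k)))\<^sup>2 * (1 / s)))"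
  proof (intro sum.cong refl)
    fix p assume "p \<in> {..<n}"
    then have "cnj ((D * e) $$ (p, 0)) * (D * e) $$ (p, 0) =
        (D $$ (p, k) * cnj (D $$ (p, k))) * complex_of_real (1 / sqrt s * (1 / sqrt s))"
      using \<open>p \<in> _\<close> by (simp only: De lessThan_iff complex_cnj_mult complex_cnj_complex_of_real of_real_mult mult_ac)
    also have "1 / sqrt s * (1 / sqrt s) = 1 / s" using s by simp
    also have "D $$ (p, k) * cnj (D $$ (p, k)) = complex_of_real ((cmod (D $$ (p, k)))\<^sup>2)"
      by (rule complex_norm_square[symmetric])
    finally show "cnj ((D * e) $$ (p, 0)) * (D * e) $$ (p, 0) =
        complex_of_real ((cmod (D $$ (p, k)))\<^sup>2 * (1 / s))" by simp
  qed
  also have "\<dots> = complex_of_real (s * (1 / s))"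
    by (simp only: s_def sum_distrib_right of_real_sum)
  also have "\<dots> = 1" using s by simp
  finally have "adj (D * e) * (D * e) = 1\<^sub>m 1"
    using e by (intro eq_matI) (auto simp del: index_mult_mat(1))
  then show ?thesis using that e by blast
qed

text \<open>A finite subset forms the columns of an isometry, so \<open>isometry_dim_le\<close>
  bounds all finite subsets by n. The invariant also keeps the vectors not yet used orthogonal to
  the columns, which is what appending the next one needs.\<close>

lemma orthonormal_finite:
  assumes S: "S \<subseteq> carrier_mat n 1" "\<And>u. u \<in> S \<Longrightarrow> adj u * u = 1\<^sub>m 1"
    and orth: "\<And>u v. u \<in> S \<Longrightarrow> v \<in> S \<Longrightarrow> u \<noteq> v \<Longrightarrow> adj u * v = 0\<^sub>m 1 1"
  shows "finite S"
proof -
  have "\<exists>V. V \<in> carrier_mat n (card F) \<and> adj V * V = 1\<^sub>m (card F) \<and>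
      (\<forall>v \<in> S - F. adj V * v = 0\<^sub>m (card F) 1)" if "finite F" "F \<subseteq> S" for F
    using that
  proof (induction F)
    case empty
    have "adj (0\<^sub>m n 0) * 0\<^sub>m n 0 = 1\<^sub>m 0" by (rule eq_matI) auto
    moreover have "adj (0\<^sub>m n 0) * v = 0\<^sub>m 0 1" if "v \<in> S" for v
      by (rule eq_matI) (use S that in auto)
    ultimately show ?case by (intro exI[of _ "0\<^sub>m n 0"]) auto
  next
    case (insert w F)
    then obtain V where V: "V \<in> carrier_mat n (card F)" "adj V * V = 1\<^sub>m (card F)"
      "\<forall>v \<in> S - F. adj V * v = 0\<^sub>m (card F) 1" by auto
    have w: "w \<in> carrier_mat n 1" "w \<in> S" "w \<notin> F" using insert S by auto
    show ?case
    proof (intro exI[of _ "append_col V w"] conjI ballI)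
      show "append_col V w \<in> carrier_mat n (card (insert w F))"
        using append_col_carrier V insert by simp
      show "adj (append_col V w) * append_col V w = 1\<^sub>m (card (insert w F))"
        using append_col_isometry[OF V(1,2) w(1)] S(2) V(3) w insert by simp
      fix v assume v: "v \<in> S - insert w F"
      then have "v \<in> carrier_mat n 1" "adj w * v = 0\<^sub>m 1 1" using S(1) orth w by auto
      then show "adj (append_col V w) * v = 0\<^sub>m (card (insert w F)) 1"
        using append_col_adj_mult_eq_0[OF V(1) w(1)] V(3) v insert by simp
    qed
  qed
  then have "card F \<le> n" if "finite F" "F \<subseteq> S" for F
    using isometry_dim_le that by blast
  then show ?thesis by (metis finite_if_finite_subsets_card_bdd)
qed

text \<open>Among the isometries whose columns are annihilated by all of \<open>T\<close>, which
  have at most n columns, take one with the most. If some \<rho> in \<open>S\<close> were not fixed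
  by its range projection, a unit vector in the range of \<open>D\<close> would be orthogonal to all
  columns, and annihilated by \<open>T\<close> because \<rho> \<tau> = 0, so it could be appended.
  Thus \<open>P\<close> projects onto the joint kernel of \<open>T\<close>, which contains the
  support of every member of \<open>S\<close>.\<close>

lemma support_projection:
  assumes S: "\<And>\<rho>. \<rho> \<in> S \<Longrightarrow> psd n \<rho>" and T: "\<And>\<tau>. \<tau> \<in> T \<Longrightarrow> psd n \<tau>"
    and ST: "\<And>\<rho> \<tau>. \<rho> \<in> S \<Longrightarrow> \<tau> \<in> T \<Longrightarrow> \<rho> * \<tau> = 0\<^sub>m n n"
  obtains P where "P \<in> carrier_mat n n" "adj P = P" "P * P = P"
    "\<And>\<rho>. \<rho> \<in> S \<Longrightarrow> P * \<rho> = \<rho>" "\<And>\<tau>. \<tau> \<in> T \<Longrightarrow> P * \<tau> = 0\<^sub>m n n"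
proof -
  define good where "good r V \<longleftrightarrow> V \<in> carrier_mat n r \<and> adj V * V = 1\<^sub>m r \<and>
    (\<forall>\<tau> \<in> T. adj V * \<tau> = 0\<^sub>m r n)" for r V
  have Tc: "\<tau> \<in> carrier_mat n n" if "\<tau> \<in> T" for \<tau> using T[OF that] by (rule psd_carrier)
  have "good 0 (0\<^sub>m n 0)"
  proof -
    have "adj (0\<^sub>m n 0) * 0\<^sub>m n 0 = 1\<^sub>m 0" by (rule eq_matI) auto
    moreover have "adj (0\<^sub>m n 0) * \<tau> = 0\<^sub>m 0 n" if "\<tau> \<in> T" for \<tau>
      by (rule eq_matI) (use Tc[OF that] in auto)
    ultimately show ?thesis by (simp add: good_def)
  qed
  moreover have "r \<le> n" if "good r V" for r V
    using that isometry_dim_le by (auto simp: good_def)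
  ultimately obtain r where r: "\<exists>V. good r V" "\<And>r' V. good r' V \<Longrightarrow> r' \<le> r"
    using Nat.ex_has_greatest_nat[of "\<lambda>r. \<exists>V. good r V" 0 n] by blast
  then obtain V where "good r V" by blast
  then have V: "V \<in> carrier_mat n r" "adj V * V = 1\<^sub>m r" "\<And>\<tau>. \<tau> \<in> T \<Longrightarrow> adj V * \<tau> = 0\<^sub>m r n"
    by (auto simp: good_def)
  let ?P = "V * adj V"
  have "V * adj V * (V * adj V) = V * ((adj V * V) * adj V)" using V(1) by (simp add: mult_assoc_dim)
  then have PP: "?P * ?P = ?P" using V by (simp add: one_mult_dim)
  have "?P * \<rho> = \<rho>" if \<rho>S: "\<rho> \<in> S" for \<rho>
  proof (rule ccontr)
    assume ne: "?P * \<rho> \<noteq> \<rho>"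
    have \<rho>: "\<rho> \<in> carrier_mat n n" "adj \<rho> = \<rho>" using S[OF \<rho>S] by (auto simp: psd_def)
    define D where "D = \<rho> - ?P * \<rho>"
    have D: "D \<in> carrier_mat n n" using \<rho> V(1) by (auto simp: D_def)
    have "D \<noteq> 0\<^sub>m n n"
    proof
      assume 0: "D = 0\<^sub>m n n"
      have "\<rho> = D + ?P * \<rho>" by (rule eq_matI) (use \<rho> V(1) in \<open>auto simp: D_def simp del: index_mult_mat(1)\<close>)
      also have "\<dots> = ?P * \<rho>" unfolding 0 by (rule left_add_zero_mat[of _ n n]) (use \<rho> V(1) in auto)
      finally show False using ne by simp
    qed
    then obtain e where e: "e \<in> carrier_mat n 1" "adj (D * e) * (D * e) = 1\<^sub>m 1"
      using nonzero_mat_unit_vector D by blast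
    have "adj V * D = adj V * \<rho> - (adj V * V) * (adj V * \<rho>)"
      using V(1) \<rho> by (simp add: D_def mult_diff_dim mult_assoc_dim)
    also have "\<dots> = 0\<^sub>m r n" using V(1,2) \<rho> by (simp add: one_mult_dim)
    finally have VD: "adj V * D = 0\<^sub>m r n" .
    have "good (Suc r) (append_col V (D * e))"
      unfolding good_def
    proof (intro conjI ballI)
      have w: "D * e \<in> carrier_mat n 1" using D e by auto
      show "append_col V (D * e) \<in> carrier_mat n (Suc r)" using V(1) by (rule append_col_carrier)
      have "adj V * (D * e) = (adj V * D) * e" using V(1) D e(1) by (simp add: mult_assoc_dim)
      then have "adj V * (D * e) = 0\<^sub>m r 1" using e(1) VD by simp
      then show "adj (append_col V (D * e)) * append_col V (D * e) = 1\<^sub>m (Suc r)"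
        using append_col_isometry[OF V(1,2) w e(2)] by simp
      fix \<tau> assume \<tau>: "\<tau> \<in> T"
      have "adj (D * e) * \<tau> = adj e * (adj D * \<tau>)"
        using D e(1) Tc[OF \<tau>] by (simp add: adj_mult mult_assoc_dim)
      also have "adj D * \<tau> = \<rho> * \<tau> - \<rho> * (V * (adj V * \<tau>))"
        using V(1) \<rho> Tc[OF \<tau>] by (simp add: D_def adj_diff adj_mult diff_mult_dim mult_assoc_dim)
      also have "\<dots> = 0\<^sub>m n n" using ST[OF \<rho>S \<tau>] V(3)[OF \<tau>] V(1) \<rho>(1) by simp
      finally have "adj (D * e) * \<tau> = 0\<^sub>m 1 n" using e(1) by simp
      then show "adj (append_col V (D * e)) * \<tau> = 0\<^sub>m (Suc r) n"
        using append_col_adj_mult_eq_0[OF V(1) w Tc[OF \<tau>] V(3)[OF \<tau>]] by simp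
    qed
    then show False using r(2) by fastforce
  qed
  moreover have "?P * \<tau> = 0\<^sub>m n n" if "\<tau> \<in> T" for \<tau>
    using V(1) V(3)[OF that] Tc[OF that] by (simp add: mult_assoc_dim)
  moreover have "adj ?P = ?P" "?P \<in> carrier_mat n n" using V(1) by (auto simp: adj_mult)
  ultimately show ?thesis using that PP by blast
qed

subsection \<open>From a decomposition to a channel\<close>

definition purifiable :: "nat \<Rightarrow> complex mat set \<Rightarrow> bool" where
  "purifiable n M \<longleftrightarrow> (\<exists>m \<Lambda>. cptp n m \<Lambda> \<and>
     (\<forall>\<rho> \<in> M. mtrace (\<Lambda> \<rho> * \<Lambda> \<rho>) = 1) \<and>
     (\<exists>\<Lambda>'. cptp m n \<Lambda>' \<and> (\<forall>\<rho> \<in> M. \<Lambda>' (\<Lambda> \<rho>) = \<rho>)))"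

lemma cp_map_zero: "cp_map n m \<Lambda> \<Longrightarrow> \<Lambda> (0\<^sub>m n n) = 0\<^sub>m m m"
proof -
  assume cp: "cp_map n m \<Lambda>"
  have "\<Lambda> (0\<^sub>m n n) = \<Lambda> (0 \<cdot>\<^sub>m 0\<^sub>m n n)" by (rule arg_cong[of _ _ \<Lambda>], rule eq_matI) auto
  also have "\<dots> = 0 \<cdot>\<^sub>m \<Lambda> (0\<^sub>m n n)" using cp zero_carrier_mat[of n n] unfolding cp_map_def by blast
  also have "\<dots> = 0\<^sub>m m m"
    using carrier_matD[OF cp_map_carrier[OF cp zero_carrier_mat]] by (intro eq_matI) auto
  finally show ?thesis .
qed

lemma purifiable_empty: "purifiable n {}"
proof -
  have "cptp n n (\<lambda>X. 1\<^sub>m n * X * adj (1\<^sub>m n))" by (rule cptp_conj) auto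
  then show ?thesis unfolding purifiable_def by blast
qed

text \<open>The output space is the direct sum of the two old ones, embedded by the isometries
  \<open>J\<close> and \<open>K\<close>. The new channel measures \<open>P\<close> against
  \<open>Q\<close> and applies the channel of that side; the recovery measures the summand and
  applies its recovery. On the given states one outcome has probability zero, so outputs stay
  pure.\<close>

lemma purifiable_Un:
  assumes M1: "\<And>\<rho>. \<rho> \<in> M1 \<Longrightarrow> density n \<rho>" and M2: "\<And>\<rho>. \<rho> \<in> M2 \<Longrightarrow> density n \<rho>"
    and orth: "orth_sets M1 M2" and "purifiable n M1" "purifiable n M2"
  shows "purifiable n (M1 \<union> M2)"
proof -
  obtain a \<Lambda>1 \<Lambda>1' where 1: "cptp n a \<Lambda>1" "\<And>\<rho>. \<rho> \<in> M1 \<Longrightarrow> mtrace (\<Lambda>1 \<rho> * \<Lambda>1 \<rho>) = 1"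
    "cptp a n \<Lambda>1'" "\<And>\<rho>. \<rho> \<in> M1 \<Longrightarrow> \<Lambda>1' (\<Lambda>1 \<rho>) = \<rho>"
    using assms(4) unfolding purifiable_def by blast
  obtain b \<Lambda>2 \<Lambda>2' where 2: "cptp n b \<Lambda>2" "\<And>\<rho>. \<rho> \<in> M2 \<Longrightarrow> mtrace (\<Lambda>2 \<rho> * \<Lambda>2 \<rho>) = 1"
    "cptp b n \<Lambda>2'" "\<And>\<rho>. \<rho> \<in> M2 \<Longrightarrow> \<Lambda>2' (\<Lambda>2 \<rho>) = \<rho>"
    using assms(5) unfolding purifiable_def by blast
  have psd: "psd n \<rho>" if "\<rho> \<in> M1 \<union> M2" for \<rho> using that M1 M2 by (auto simp: density_def)
  obtain P where P: "P \<in> carrier_mat n n" "adj P = P" "P * P = P"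
    "\<And>\<rho>. \<rho> \<in> M1 \<Longrightarrow> P * \<rho> = \<rho>" "\<And>\<tau>. \<tau> \<in> M2 \<Longrightarrow> P * \<tau> = 0\<^sub>m n n"
    by (rule support_projection[of M1 n M2])
      (use psd orth in \<open>auto simp: orth_sets_def intro: psd_mtrace_mult_eq_0\<close>)
  define Q where "Q = 1\<^sub>m n - P"
  have Q: "Q \<in> carrier_mat n n" "adj Q = Q" using P by (auto simp: Q_def adj_diff)
  have QQ: "Q * Q = Q"
  proof -
    have "Q * Q = Q - Q * P" using Q P by (subst (2) Q_def) (simp add: mult_diff_dim mult_one_dim)
    also have "Q * P = 0\<^sub>m n n" using P by (simp add: Q_def diff_mult_dim one_mult_dim)
    finally show ?thesis using Q by simp
  qed
  have PQ: "adj P * P + adj Q * Q = 1\<^sub>m n"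
    unfolding P(2,3) Q(2) QQ by (rule eq_matI) (use P in \<open>auto simp: Q_def\<close>)
  define J where "J = mat (a + b) a (\<lambda>(i, j). of_bool (i = j) :: complex)"
  define K where "K = mat (a + b) b (\<lambda>(i, j). of_bool (i = a + j) :: complex)"
  have J: "J \<in> carrier_mat (a + b) a" and K: "K \<in> carrier_mat (a + b) b" by (auto simp: J_def K_def)
  have JJ: "adj J * J = 1\<^sub>m a"
    by (rule eq_matI) (auto simp: adj_mult_index J_def sum_of_bool simp del: index_mult_mat(1))
  have KK: "adj K * K = 1\<^sub>m b"
    by (rule eq_matI) (auto simp: adj_mult_index K_def sum_of_bool simp del: index_mult_mat(1))
  have JK: "adj J * K = 0\<^sub>m a b"
    by (rule eq_matI) (auto simp: adj_mult_index J_def K_def sum_of_bool simp del: index_mult_mat(1))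
  have KJ: "adj K * J = 0\<^sub>m b a" using adj_mult_eq_0_comm[of J K] J K JK by simp
  have sumJK: "J * adj J + K * adj K = 1\<^sub>m (a + b)"
  proof -
    \<comment> \<open>Entries of an embedding at offset c times its adjoint: c = 0 gives
      \<open>J * adj J\<close>, and c = a gives \<open>K * adj K\<close>.\<close>
    have shift: "(\<Sum>k<m. of_bool (i = c + k) * of_bool (j = c + k)) = (of_bool (c \<le> i \<and> i < c + m \<and> i = j) :: complex)"
      for i j c m :: nat
    proof (cases "c \<le> i \<and> i < c + m")
      case True
      have "(\<Sum>k<m. of_bool (i = c + k) * of_bool (j = c + k)) =
          (\<Sum>k<m. of_bool (k = i - c) * of_bool (j = c + k) :: complex)"
        by (intro sum.cong) (use True in auto)
      then show ?thesis using True by (auto simp: sum_of_bool)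
    qed (auto intro!: sum.neutral)
    show ?thesis
      by (rule eq_matI)
        (auto simp: mult_adj_index J_def K_def shift shift[where c = 0, simplified] simp del: index_mult_mat(1))
  qed
  define \<Lambda> where "\<Lambda> X = J * \<Lambda>1 (P * X * adj P) * adj J + K * \<Lambda>2 (Q * X * adj Q) * adj K" for X
  define \<Lambda>' where "\<Lambda>' Y = \<Lambda>1' (adj J * Y * adj (adj J)) + \<Lambda>2' (adj K * Y * adj (adj K))" for Y
  have cp: "cptp n (a + b) \<Lambda>"
    unfolding \<Lambda>_def
    by (rule cptp_sum2[where a = n and b = n, OF cptp_comp[OF 1(1) cptp_conj[OF J JJ]]
          cptp_comp[OF 2(1) cptp_conj[OF K KK]] P(1) Q(1) PQ])
  have cp': "cptp (a + b) n \<Lambda>'"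
    unfolding \<Lambda>'_def
    by (rule cptp_sum2[OF 1(3) 2(3)]) (use J K sumJK in auto)
  have herm: "\<rho> * A = \<rho>" if "psd n \<rho>" "A \<in> carrier_mat n n" "adj A = A" "A * \<rho> = \<rho>" for \<rho> A
  proof -
    have h: "\<rho> \<in> carrier_mat n n" "adj \<rho> = \<rho>" using that(1) by (auto simp: psd_def)
    have "\<rho> * A = adj (A * \<rho>)" using h that(2,3) by (simp add: adj_mult)
    then show ?thesis by (simp only: that(4) h(2))
  qed
  have cp1: "cp_map n a \<Lambda>1" "cp_map n b \<Lambda>2" "cp_map a n \<Lambda>1'" "cp_map b n \<Lambda>2'"
    using 1 2 by (auto simp: cptp_iff)
  have sq: "mtrace (V * Y * adj V * (V * Y * adj V)) = mtrace (Y * Y)"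
    if "V \<in> carrier_mat p q" "adj V * V = 1\<^sub>m q" "Y \<in> carrier_mat q q" for V Y p q
  proof -
    have "V * Y * adj V * (V * Y * adj V) = V * (Y * ((adj V * V) * Y)) * adj V"
      using that(1,3) by (simp add: mult_assoc_dim)
    then have "V * Y * adj V * (V * Y * adj V) = V * (Y * Y) * adj V"
      using that by (simp add: one_mult_dim)
    then show ?thesis using mtrace_conj[OF that(1,2)] that(3) by simp
  qed
  \<comment> \<open>What the measurement in the recovery sees: the summand that holds the output
    returns it, the other one returns zero.\<close>
  have inv: "adj V * (V * Y * adj V) * V = Y" "adj W * (V * Y * adj V) * W = 0\<^sub>m r r"
    if "V \<in> carrier_mat p q" "adj V * V = 1\<^sub>m q" "Y \<in> carrier_mat q q" "W \<in> carrier_mat p r"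
      "adj W * V = 0\<^sub>m r q" for V W Y p q r
  proof -
    have "adj V * (V * Y * adj V) * V = (adj V * V) * (Y * (adj V * V))"
      using that(1,3) by (simp add: mult_assoc_dim)
    then show "adj V * (V * Y * adj V) * V = Y" using that by (simp add: one_mult_dim mult_one_dim)
    have "adj W * (V * Y * adj V) * W = (adj W * V) * (Y * adj V * W)"
      using that(1,3,4) by (simp add: mult_assoc_dim)
    then show "adj W * (V * Y * adj V) * W = 0\<^sub>m r r"
      using that by (simp add: left_mult_zero_mat[of _ q r])
  qed
  have on1: "mtrace (\<Lambda> \<rho> * \<Lambda> \<rho>) = 1 \<and> \<Lambda>' (\<Lambda> \<rho>) = \<rho>" if \<rho>: "\<rho> \<in> M1" for \<rho>
  proof -
    have \<rho>c: "\<rho> \<in> carrier_mat n n" "psd n \<rho>" using psd[of \<rho>] \<rho> psd_carrier by auto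
    have "P * \<rho> * adj P = \<rho>" using P \<rho> herm[OF \<rho>c(2) P(1,2)] by simp
    moreover have "Q * \<rho> * adj Q = 0\<^sub>m n n"
      using P(1) P(4)[OF \<rho>] \<rho>c Q by (simp add: Q_def diff_mult_dim one_mult_dim)
    moreover have Y: "\<Lambda>1 \<rho> \<in> carrier_mat a a" using cp1 \<rho>c cp_map_carrier by blast
    ultimately have eq: "\<Lambda> \<rho> = J * \<Lambda>1 \<rho> * adj J"
      using cp_map_zero[OF cp1(2)] K J by (simp add: \<Lambda>_def right_add_zero_mat[of _ "a + b" "a + b"])
    have "\<Lambda>' (\<Lambda> \<rho>) = \<rho>"
      unfolding \<Lambda>'_def eq adj_adj inv[OF J JJ Y K KJ] using cp_map_zero[OF cp1(4)] 1(4)[OF \<rho>] \<rho>c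
      by simp
    then show ?thesis unfolding eq sq[OF J JJ Y] using 1(2)[OF \<rho>] eq by simp
  qed
  have on2: "mtrace (\<Lambda> \<rho> * \<Lambda> \<rho>) = 1 \<and> \<Lambda>' (\<Lambda> \<rho>) = \<rho>" if \<rho>: "\<rho> \<in> M2" for \<rho>
  proof -
    have \<rho>c: "\<rho> \<in> carrier_mat n n" "psd n \<rho>" using psd[of \<rho>] \<rho> psd_carrier by auto
    have Q\<rho>: "Q * \<rho> = \<rho>" using P(1) P(5)[OF \<rho>] \<rho>c by (simp add: Q_def diff_mult_dim one_mult_dim)
    then have "Q * \<rho> * adj Q = \<rho>" using Q herm[OF \<rho>c(2) Q(1,2)] by simp
    moreover have "P * \<rho> * adj P = 0\<^sub>m n n"
      using P(1,2) P(5)[OF \<rho>] by simp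
    moreover have Y: "\<Lambda>2 \<rho> \<in> carrier_mat b b" using cp1 \<rho>c cp_map_carrier by blast
    ultimately have eq: "\<Lambda> \<rho> = K * \<Lambda>2 \<rho> * adj K"
      using cp_map_zero[OF cp1(1)] K J by (simp add: \<Lambda>_def left_add_zero_mat[of _ "a + b" "a + b"])
    have "\<Lambda>' (\<Lambda> \<rho>) = \<rho>"
      unfolding \<Lambda>'_def eq adj_adj inv[OF K KK Y J JK] using cp_map_zero[OF cp1(3)] 2(4)[OF \<rho>] \<rho>c
      by simp
    then show ?thesis unfolding eq sq[OF K KK Y] using 2(2)[OF \<rho>] eq by simp
  qed
  show ?thesis unfolding purifiable_def using cp cp' on1 on2 by blast
qed

text \<open>The recovery runs the same circuit backwards: attach \<sigma>, apply \<open>U\<close>,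
  trace out H_C. Both partial traces act on product states, so they return the kept factor because
  \<sigma> and \<omega> have trace one.\<close>

lemma essentially_pure_purifiable:
  assumes M: "\<And>\<rho>. \<rho> \<in> M \<Longrightarrow> density n \<rho>" and "essentially_pure n M"
  shows "purifiable n M"
proof -
  obtain dC dA dB \<sigma> \<omega> U where
    dim: "n * dC = dA * dB" and \<sigma>: "density dB \<sigma>" and \<omega>: "density dC \<omega>"
    and U: "unitary_mat (n * dC) (dA * dB) U"
    and sub: "{kron \<rho> \<omega> | \<rho>. \<rho> \<in> M} \<subseteq> {U * kron (outer \<phi>) \<sigma> * adj U | \<phi>. unit_vec_c dA \<phi>}"
    using assms(2) unfolding essentially_pure_def by blast
  have Uc: "U \<in> carrier_mat (n * dC) (dA * dB)" "U * adj U = 1\<^sub>m (n * dC)" "adj U * U = 1\<^sub>m (dA * dB)"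
    using U by (auto simp: unitary_mat_def)
  have c: "\<sigma> \<in> carrier_mat dB dB" "\<omega> \<in> carrier_mat dC dC" "mtrace \<sigma> = 1" "mtrace \<omega> = 1"
    using \<sigma> \<omega> psd_carrier by (auto simp: density_def)
  define \<Lambda> where "\<Lambda> X = ptrace dA dB (adj U * kron X \<omega> * adj (adj U))" for X
  define \<Lambda>' where "\<Lambda>' Y = ptrace n dC (U * kron Y \<sigma> * adj U)" for Y
  have "cptp (n * dC) (dA * dB) (\<lambda>X. adj U * X * adj (adj U))"
    by (rule cptp_conj) (use Uc in auto)
  then have cp: "cptp n dA \<Lambda>"
    unfolding \<Lambda>_def by (rule cptp_comp[OF cptp_comp[OF cptp_kron[OF \<omega>]] cptp_ptrace])
  have "cptp (dA * dB) (n * dC) (\<lambda>X. U * X * adj U)"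
    by (rule cptp_conj) (use Uc in auto)
  then have cp': "cptp dA n \<Lambda>'"
    unfolding \<Lambda>'_def by (rule cptp_comp[OF cptp_comp[OF cptp_kron[OF \<sigma>]] cptp_ptrace])
  have "mtrace (\<Lambda> \<rho> * \<Lambda> \<rho>) = 1 \<and> \<Lambda>' (\<Lambda> \<rho>) = \<rho>" if \<rho>: "\<rho> \<in> M" for \<rho>
  proof -
    have \<rho>c: "\<rho> \<in> carrier_mat n n" using M[OF \<rho>] psd_carrier by (auto simp: density_def)
    obtain \<phi> where \<phi>: "unit_vec_c dA \<phi>" "kron \<rho> \<omega> = U * kron (outer \<phi>) \<sigma> * adj U"
      using sub \<rho> by blast
    let ?u = "column_mat \<phi>"
    have u: "?u \<in> carrier_mat dA 1" "adj ?u * ?u = 1\<^sub>m 1" using \<phi> by (auto simp: unit_vec_c_iff)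
    have oc: "outer \<phi> \<in> carrier_mat dA dA" using u by (auto simp: outer_column_mat)
    have "adj U * kron \<rho> \<omega> * adj (adj U) = (adj U * U) * kron (outer \<phi>) \<sigma> * (adj U * U)"
      unfolding \<phi>(2) using Uc(1) oc c(1) by (simp add: mult_assoc_dim)
    also have "\<dots> = kron (outer \<phi>) \<sigma>" unfolding Uc(3) using oc c(1) by (simp add: one_mult_dim mult_one_dim)
    finally have \<Lambda>\<rho>: "\<Lambda> \<rho> = outer \<phi>" using ptrace_kron[OF oc c(1)] c(3) oc
      by (simp add: \<Lambda>_def)
    have "\<Lambda>' (\<Lambda> \<rho>) = \<rho>"
      unfolding \<Lambda>\<rho> \<Lambda>'_def \<phi>(2)[symmetric] using ptrace_kron[OF \<rho>c c(2)] c(4) by simp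
    moreover have "outer \<phi> * outer \<phi> = ?u * ((adj ?u * ?u) * adj ?u)"
      unfolding outer_column_mat using u(1) by (simp add: mult_assoc_dim)
    then have "mtrace (outer \<phi> * outer \<phi>) = mtrace (?u * adj ?u)"
      unfolding u(2) by (simp add: one_mult_dim)
    moreover have "mtrace (?u * adj ?u) = mtrace (adj ?u * ?u)"
      using u(1) by (intro mtrace_comm) auto
    ultimately show ?thesis using u(2) by (simp add: \<Lambda>\<rho> mtrace_def)
  qed
  then show ?thesis unfolding purifiable_def using cp cp' by blast
qed

section \<open>Finiteness of the nonempty parts and their union\<close>

lemma one_mat_1_neq_zero: "(1\<^sub>m 1 :: complex mat) \<noteq> 0\<^sub>m 1 1"
  by (metis index_one_mat(1) index_zero_mat(1) less_numeral_extra(1) zero_neq_one)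

text \<open>Each part contributes a unit vector from the range of one of its states, which is
  nonzero by its trace. States of different parts have product zero, so these vectors are
  orthonormal in C^n.\<close>

lemma finite_orth_family:
  assumes d: "\<And>i \<rho>. i \<in> I \<Longrightarrow> \<rho> \<in> Ms i \<Longrightarrow> density n \<rho>"
    and orth: "\<And>i j. i \<in> I \<Longrightarrow> j \<in> I \<Longrightarrow> i \<noteq> j \<Longrightarrow> orth_sets (Ms i) (Ms j)"
    and ne: "\<And>i. i \<in> I \<Longrightarrow> Ms i \<noteq> {}"
  shows "finite I"
proof -
  have "\<exists>\<rho> e. \<rho> \<in> Ms i \<and> e \<in> carrier_mat n 1 \<and> adj (\<rho> * e) * (\<rho> * e) = 1\<^sub>m 1" if i: "i \<in> I" for i
  proof -
    obtain \<rho> where \<rho>: "\<rho> \<in> Ms i" using ne i by blast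
    then have "\<rho> \<in> carrier_mat n n" "\<rho> \<noteq> 0\<^sub>m n n"
      using d[OF i \<rho>] psd_carrier by (auto simp: density_def mtrace_def)
    then show ?thesis using nonzero_mat_unit_vector \<rho> by metis
  qed
  then obtain \<rho> e where \<rho>e: "\<And>i. i \<in> I \<Longrightarrow> \<rho> i \<in> Ms i" "\<And>i. i \<in> I \<Longrightarrow> e i \<in> carrier_mat n 1"
    "\<And>i. i \<in> I \<Longrightarrow> adj (\<rho> i * e i) * (\<rho> i * e i) = 1\<^sub>m 1" by metis
  have psd: "psd n (\<rho> i)" if "i \<in> I" for i using d \<rho>e that by (auto simp: density_def)
  define w where "w i = \<rho> i * e i" for i
  have wc: "w i \<in> carrier_mat n 1" if "i \<in> I" for i
    unfolding w_def using that by (intro mult_carrier_mat[OF psd_carrier[OF psd] \<rho>e(2)])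
  have w1: "adj (w i) * w i = 1\<^sub>m 1" if "i \<in> I" for i using \<rho>e that by (simp add: w_def)
  have w0: "adj (w i) * w j = 0\<^sub>m 1 1" if "i \<in> I" "j \<in> I" "i \<noteq> j" for i j
  proof -
    have c: "\<rho> i \<in> carrier_mat n n" "\<rho> j \<in> carrier_mat n n" "adj (\<rho> i) = \<rho> i"
      using psd that by (auto simp: psd_def)
    have "mtrace (\<rho> i * \<rho> j) = 0" using orth \<rho>e that by (auto simp: orth_sets_def)
    then have "\<rho> i * \<rho> j = 0\<^sub>m n n" using psd psd_mtrace_mult_eq_0 that by blast
    moreover have "adj (w i) * w j = adj (e i) * ((\<rho> i * \<rho> j) * e j)"
      using c \<rho>e(2)[OF that(1)] \<rho>e(2)[OF that(2)] by (simp add: w_def adj_mult mult_assoc_dim)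
    ultimately show ?thesis using \<rho>e(2)[OF that(1)] \<rho>e(2)[OF that(2)] by simp
  qed
  \<comment> \<open>Equal vectors at different indices would have inner product both 1 and
    0.\<close>
  have inj: "inj_on w I"
    using w0 w1 one_mat_1_neq_zero by (intro inj_onI) metis
  have "finite (w ` I)"
    by (rule orthonormal_finite[of _ n]) (use wc w1 w0 in auto)
  then show ?thesis using inj finite_imageD by blast
qed

lemma purifiable_Union:
  assumes M: "M = (\<Union>i\<in>I. Ms i)" and d: "\<And>\<rho>. \<rho> \<in> M \<Longrightarrow> density n \<rho>"
    and orth: "\<And>i j. i \<in> I \<Longrightarrow> j \<in> I \<Longrightarrow> i \<noteq> j \<Longrightarrow> orth_sets (Ms i) (Ms j)"
    and ep: "\<And>i. i \<in> I \<Longrightarrow> essentially_pure n (Ms i)"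
  shows "purifiable n M"
proof -
  \<comment> \<open>Infinitely many indices may carry the empty set, which is orthogonal to
    everything, so only the others can be counted.\<close>
  define J where "J = {i \<in> I. Ms i \<noteq> {}}"
  have "finite J" by (rule finite_orth_family[of J Ms n]) (use M d orth in \<open>auto simp: J_def\<close>)
  moreover have "purifiable n (\<Union>i\<in>F. Ms i)" if "finite F" "F \<subseteq> I" for F
    using that
  proof (induction F)
    case (insert i F)
    have i: "i \<in> I" using insert.prems by simp
    have dens: "density n \<rho>" if "\<rho> \<in> Ms j" "j \<in> I" for j \<rho>
      using d M that by auto
    have "purifiable n (Ms i \<union> (\<Union>j\<in>F. Ms j))"
    proof (rule purifiable_Un)
      have "orth_sets (Ms i) (Ms j)" if "j \<in> F" for j
        using orth[of i j] i that insert by auto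
      then show "orth_sets (Ms i) (\<Union>j\<in>F. Ms j)"
        unfolding orth_sets_def by blast
      show "purifiable n (Ms i)"
        using dens i ep[OF i] by (intro essentially_pure_purifiable)
    qed (use insert dens i in auto)
    then show ?case by simp
  qed (simp add: purifiable_empty)
  moreover have "(\<Union>i\<in>J. Ms i) = M" using M by (auto simp: J_def)
  moreover have "J \<subseteq> I" by (auto simp: J_def)
  ultimately show ?thesis by metis
qed

subsection \<open>From a channel to a decomposition\<close>

text \<open>The flip from C^N \<otimes> C^n to C^n \<otimes> C^N as a permutation matrix: it sends
  e_a \<otimes> e_b, at index \<open>a * n + b\<close>, to e_b \<otimes> e_a, at index
  \<open>b * N + a\<close>.\<close>

definition swap_mat :: "nat \<Rightarrow> nat \<Rightarrow> complex mat" where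
  "swap_mat n N = mat (n * N) (N * n) (\<lambda>(i, j). of_bool (j = i mod N * n + i div N))"

lemma dim_swap_mat [simp]: "dim_row (swap_mat n N) = n * N" "dim_col (swap_mat n N) = N * n"
  by (simp_all add: swap_mat_def)

lemma swap_index_less:
  fixes i n N :: nat
  assumes "i < n * N"
  shows "i mod N * n + i div N < N * n"
  using div_mod_less[OF assms] by (intro index_mult_less)

lemma swap_index_iff:
  fixes i j n N :: nat
  assumes "i < n * N" "j < N * n"
  shows "j = i mod N * n + i div N \<longleftrightarrow> i = j mod n * N + j div n"
proof -
  have *: "i = j mod n * N + j div n" if "i < n * N" "j = i mod N * n + i div N" for i j n N :: nat
    using div_mod_less[OF that(1)] by (simp add: that(2))
  show ?thesis using *[of i n N j] *[of j N n i] assms by blast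
qed

lemma swap_mult_index:
  assumes "X \<in> carrier_mat (N * n) r" "i < n * N" "j < r"
  shows "(swap_mat n N * X) $$ (i, j) = X $$ (i mod N * n + i div N, j)"
proof -
  have "(swap_mat n N * X) $$ (i, j) = (\<Sum>k<N * n. of_bool (k = i mod N * n + i div N) * X $$ (k, j))"
    using assms by (simp add: mult_index swap_mat_def del: index_mult_mat(1))
  then show ?thesis using swap_index_less[OF assms(2)] by (simp only: sum_of_bool)
qed

lemma mult_swap_index:
  assumes "X \<in> carrier_mat r (n * N)" "i < r" "j < N * n"
  shows "(X * swap_mat n N) $$ (i, j) = X $$ (i, j mod n * N + j div n)"
proof -
  have "(X * swap_mat n N) $$ (i, j) = (\<Sum>k<n * N. X $$ (i, k) * swap_mat n N $$ (k, j))"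
    using assms by (subst mult_index) auto
  also have "\<dots> = (\<Sum>k<n * N. X $$ (i, k) * of_bool (k = j mod n * N + j div n))"
    using assms swap_index_iff by (intro sum.cong) (auto simp: swap_mat_def)
  finally show ?thesis using swap_index_less[OF assms(3)] by (simp only: sum_of_bool)
qed

lemma swap_mult_adj: "swap_mat n N * adj (swap_mat n N) = 1\<^sub>m (n * N)"
proof (rule eq_matI)
  fix i j assume "i < dim_row (1\<^sub>m (n * N) :: complex mat)" "j < dim_col (1\<^sub>m (n * N) :: complex mat)"
  then have ij: "i < n * N" "j < n * N" by auto
  let ?s = "\<lambda>i. i mod N * n + i div N"
  have "(swap_mat n N * adj (swap_mat n N)) $$ (i, j) = of_bool (?s i = ?s j)"
    using ij swap_index_less[OF ij(1)]
    by (subst swap_mult_index[where r = "n * N"]) (auto simp: swap_mat_def intro!: carrier_matI)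
  moreover have "?s i = ?s j \<longleftrightarrow> i = j"
    using swap_index_iff[OF ij(1) swap_index_less[OF ij(2)]]
      swap_index_iff[OF ij(2) swap_index_less[OF ij(2)]] by auto
  ultimately show "(swap_mat n N * adj (swap_mat n N)) $$ (i, j) = 1\<^sub>m (n * N) $$ (i, j)"
    using ij by auto
qed auto

lemma swap_kron:
  assumes "A \<in> carrier_mat N N"
  shows "swap_mat n N * kron A (1\<^sub>m n) = kron (1\<^sub>m n) A * swap_mat n N"
proof (rule eq_matI)
  fix i j assume "i < dim_row (kron (1\<^sub>m n) A * swap_mat n N)" "j < dim_col (kron (1\<^sub>m n) A * swap_mat n N)"
  then have ij: "i < n * N" "j < N * n" using assms by auto
  note d = div_mod_less[OF ij(1)] div_mod_less[OF ij(2)]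
  have "(swap_mat n N * kron A (1\<^sub>m n)) $$ (i, j) = kron A (1\<^sub>m n) $$ (i mod N * n + i div N, j)"
    by (rule swap_mult_index[where r = "N * n"]) (use ij assms in auto)
  also have "\<dots> = kron (1\<^sub>m n) A $$ (i, j mod n * N + j div n)"
    using assms ij d swap_index_less[OF ij(1)] swap_index_less[OF ij(2)] by simp
  also have "\<dots> = (kron (1\<^sub>m n) A * swap_mat n N) $$ (i, j)"
    by (rule mult_swap_index[where r = "n * N", symmetric]) (use ij assms in auto)
  finally show "(swap_mat n N * kron A (1\<^sub>m n)) $$ (i, j) = (kron (1\<^sub>m n) A * swap_mat n N) $$ (i, j)" .
qed (use assms in auto)

text \<open>\<open>U\<close> sends V x \<otimes> y to x \<otimes> V y and is the flip where the
  first factor is orthogonal to the range of \<open>V\<close>. The images of the two pieces are C^n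
  \<otimes> range V and C^n \<otimes> its complement, so they fit together to a unitary.\<close>

lemma isometry_unitary_extension:
  assumes V: "V \<in> carrier_mat N n" "adj V * V = 1\<^sub>m n"
  obtains U where "unitary_mat (n * N) (N * n) U"
    "\<And>\<rho> \<tau>. \<rho> \<in> carrier_mat n n \<Longrightarrow> \<tau> \<in> carrier_mat n n \<Longrightarrow>
      U * kron (V * \<rho> * adj V) \<tau> * adj U = kron \<rho> (V * \<tau> * adj V)"
proof -
  define Q where "Q = 1\<^sub>m N - V * adj V"
  let ?S = "swap_mat n N"
  let ?K = "kron Q (1\<^sub>m n)"
  define U where "U = kron (adj V) V + ?S * ?K"
  have Q: "Q \<in> carrier_mat N N" "adj Q = Q" using V(1) by (auto simp: Q_def adj_diff adj_mult)
  have V0: "adj V * (V * X) = X" if "dim_row X = n" for X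
  proof -
    have "adj V * (V * X) = (adj V * V) * X" using V(1) that by (simp add: mult_assoc_dim)
    then show ?thesis using V(2) that by (simp add: one_mult_dim)
  qed
  have VQ: "adj V * Q = 0\<^sub>m n N" using V(1) by (simp add: Q_def mult_diff_dim mult_one_dim V0)
  have QV: "Q * V = 0\<^sub>m N n" using adj_mult_eq_0_comm[of V Q] V(1) Q VQ by simp
  have QQ: "Q * Q = Q"
  proof -
    have "Q * Q = Q - V * (adj V * Q)"
      using Q(1) V(1) by (subst (1) Q_def) (simp add: diff_mult_dim one_mult_dim mult_assoc_dim)
    then show ?thesis using Q(1) V(1) VQ by simp
  qed
  have d: "dim_row V = N" "dim_col V = n" "dim_row Q = N" "dim_col Q = N" using V Q by auto
  have U: "U \<in> carrier_mat (n * N) (N * n)" by (rule carrier_matI) (simp_all add: U_def d)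
  have adjU: "adj U = kron V (adj V) + ?K * adj ?S"
    by (simp add: U_def adj_add adj_mult adj_kron d Q(2))
  have SK: "?S * ?K = kron (1\<^sub>m n) Q * ?S" by (rule swap_kron) (rule Q)
  have "U * adj U = 1\<^sub>m (n * N)"
  proof -
    have 1: "kron (adj V) V * adj U = kron (1\<^sub>m n) (V * adj V)"
    proof -
      have "kron (adj V) V * adj U = kron (adj V) V * kron V (adj V) + (kron (adj V) V * ?K) * adj ?S"
        unfolding adjU by (simp add: mult_add_dim mult_assoc_dim d)
      also have "kron (adj V) V * ?K = 0\<^sub>m (n * N) (N * n)"
        by (simp add: kron_mult d VQ kron_zero_left)
      finally show ?thesis by (simp add: kron_mult d V(2))
    qed
    have "(?S * ?K) * adj U = ?S * (?K * kron V (adj V)) + ?S * (?K * ?K) * adj ?S"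
      unfolding adjU by (simp add: mult_add_dim mult_assoc_dim d)
    also have "?K * kron V (adj V) = 0\<^sub>m (N * n) (n * N)"
      by (simp add: kron_mult d QV kron_zero_left)
    also have "?K * ?K = ?K" by (simp add: kron_mult d QQ one_mult_dim)
    also have "?S * ?K * adj ?S = kron (1\<^sub>m n) Q"
      unfolding SK by (simp add: mult_assoc_dim swap_mult_adj d mult_one_dim)
    finally have 2: "(?S * ?K) * adj U = kron (1\<^sub>m n) Q" by (simp add: d)
    have "U * adj U = kron (adj V) V * adj U + (?S * ?K) * adj U"
      by (subst (1) U_def) (simp add: add_mult_dim d U_def)
    also have "\<dots> = kron (1\<^sub>m n) (V * adj V + Q)"
      unfolding 1 2 by (simp add: kron_add_right d)
    also have "V * adj V + Q = 1\<^sub>m N"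
      by (rule eq_matI) (auto simp: Q_def d simp del: index_mult_mat(1))
    finally show ?thesis by (simp add: kron_one)
  qed
  moreover from this have "adj U * U = 1\<^sub>m (N * n)"
    using mat_mult_left_right_inverse[of U "n * N" "adj U"] U by (simp add: mult.commute[of N])
  ultimately have "unitary_mat (n * N) (N * n) U" using U by (simp add: unitary_mat_def)
  moreover have "U * kron (V * \<rho> * adj V) \<tau> * adj U = kron \<rho> (V * \<tau> * adj V)"
    if \<rho>: "\<rho> \<in> carrier_mat n n" "\<tau> \<in> carrier_mat n n" for \<rho> \<tau>
  proof -
    let ?L = "kron (V * \<rho> * adj V) \<tau>"
    have d': "dim_row \<rho> = n" "dim_col \<rho> = n" "dim_row \<tau> = n" "dim_col \<tau> = n" using \<rho> by auto
    have "?K * ?L = kron (Q * V * (\<rho> * adj V)) \<tau>"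
      by (simp add: kron_mult d d' one_mult_dim mult_assoc_dim)
    then have "?K * ?L = 0\<^sub>m (N * n) (N * n)" by (simp add: QV d d' kron_zero_left)
    moreover have "U * ?L = kron (adj V) V * ?L + ?S * (?K * ?L)"
      by (simp add: U_def add_mult_dim mult_assoc_dim d d')
    ultimately have UL: "U * ?L = kron (\<rho> * adj V) (V * \<tau>)"
      by (simp add: kron_mult d d' V0 mult_assoc_dim)
    have "kron (\<rho> * adj V) (V * \<tau>) * adj U =
        kron (\<rho> * adj V) (V * \<tau>) * kron V (adj V) + (kron (\<rho> * adj V) (V * \<tau>) * ?K) * adj ?S"
      unfolding adjU by (simp add: mult_add_dim mult_assoc_dim d d')
    also have "kron (\<rho> * adj V) (V * \<tau>) * ?K = 0\<^sub>m (n * N) (N * n)"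
      by (simp add: kron_mult d d' VQ mult_assoc_dim kron_zero_left)
    also have "kron (\<rho> * adj V) (V * \<tau>) * kron V (adj V) = kron \<rho> (V * \<tau> * adj V)"
      by (simp add: kron_mult d d' mult_assoc_dim V(2) mult_one_dim)
    finally show ?thesis unfolding UL by (simp add: d d')
  qed
  ultimately show ?thesis using that by blast
qed

text \<open>\<open>U\<close> exchanges the place of \<open>V\<close> in
  \<open>V * \<rho> * adj V\<close> \<otimes> \<tau>, which is also \<psi>\<psi>* \<otimes> (\<eta>
  \<otimes> \<tau>). So H_A is C^m, H_B is C^k \<otimes> C^n with state \<eta> \<otimes> \<tau>, and
  H_C is C^(m k) with state \<open>V * \<tau> * adj V\<close>. Nonemptiness of \<open>S\<close>
  provides \<tau>.\<close>

lemma essentially_pureI: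
  assumes V: "V \<in> carrier_mat (m * k) n" "adj V * V = 1\<^sub>m n"
    and S: "S \<noteq> {}" "\<And>\<rho>. \<rho> \<in> S \<Longrightarrow> density n \<rho>" and \<eta>: "density k \<eta>"
    and pure: "\<And>\<rho>. \<rho> \<in> S \<Longrightarrow> \<exists>\<psi> \<in> carrier_mat m 1. adj \<psi> * \<psi> = 1\<^sub>m 1 \<and>
      V * \<rho> * adj V = kron (\<psi> * adj \<psi>) \<eta>"
  shows "essentially_pure n S"
proof -
  obtain \<tau> where \<tau>: "density n \<tau>" using S by blast
  have \<tau>c: "\<tau> \<in> carrier_mat n n" using \<tau> psd_carrier by (auto simp: density_def)
  obtain U where U: "unitary_mat (n * (m * k)) (m * k * n) U"
    "\<And>\<rho> \<tau>. \<rho> \<in> carrier_mat n n \<Longrightarrow> \<tau> \<in> carrier_mat n n \<Longrightarrow>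
      U * kron (V * \<rho> * adj V) \<tau> * adj U = kron \<rho> (V * \<tau> * adj V)"
    using isometry_unitary_extension[OF V] by blast
  define \<omega> where "\<omega> = V * \<tau> * adj V"
  have \<omega>: "density (m * k) \<omega>"
    unfolding \<omega>_def using \<tau> psd_conj[OF _ V(1), of \<tau>] mtrace_conj[OF V \<tau>c] by (simp add: density_def)
  have "\<exists>\<phi>. unit_vec_c m \<phi> \<and> kron \<rho> \<omega> = U * kron (outer \<phi>) (kron \<eta> \<tau>) * adj U" if \<rho>: "\<rho> \<in> S" for \<rho>
  proof -
    obtain \<psi> where \<psi>: "\<psi> \<in> carrier_mat m 1" "adj \<psi> * \<psi> = 1\<^sub>m 1" "V * \<rho> * adj V = kron (\<psi> * adj \<psi>) \<eta>"
      using pure[OF \<rho>] by blast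
    obtain \<phi> where \<phi>: "\<phi> \<in> carrier_vec m" "\<psi> = column_mat \<phi>" using column_mat_surj \<psi>(1) by blast
    have "\<rho> \<in> carrier_mat n n" using S(2)[OF \<rho>] psd_carrier by (auto simp: density_def)
    from U(2)[OF this \<tau>c] have "kron \<rho> \<omega> = U * kron (outer \<phi>) (kron \<eta> \<tau>) * adj U"
      unfolding \<psi>(3) \<omega>_def by (simp add: kron_assoc outer_column_mat \<phi>(2))
    moreover have "unit_vec_c m \<phi>" using \<phi> \<psi>(2) by (simp add: unit_vec_c_iff)
    ultimately show ?thesis by blast
  qed
  then have "{kron \<rho> \<omega> | \<rho>. \<rho> \<in> S} \<subseteq> {U * kron (outer \<phi>) (kron \<eta> \<tau>) * adj U | \<phi>. unit_vec_c m \<phi>}"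
    by blast
  moreover have "n * (m * k) = m * (k * n)" by (simp add: mult_ac)
  moreover have "unitary_mat (n * (m * k)) (m * (k * n)) U" using U(1) by (simp only: mult.assoc)
  ultimately show ?thesis
    unfolding essentially_pure_def using \<omega> density_kron[OF \<eta> \<tau>] by blast
qed

section \<open>The environment vector of a reversible purification\<close>

lemma kron_one_left: "kron (1\<^sub>m 1) A = A"
  by (rule eq_matI) auto

text \<open>The environment of a reversible purification factors off as a vector \<open>c\<close>, and two pure
  outputs with different environment vectors are orthogonal, because the dilation
  preserves the inner product of \<open>\<psi>\<close> and \<open>\<phi>\<close>.\<close>

lemma environment_orth:
  assumes Z: "Z \<in> carrier_mat (m * r) m" "adj Z * Z = 1\<^sub>m m"
    and \<psi>: "\<psi> \<in> carrier_mat m 1" "Z * \<psi> = kron \<psi> c" "c \<in> carrier_mat r 1" "adj c * c = 1\<^sub>m 1"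
    and \<phi>: "\<phi> \<in> carrier_mat m 1" "Z * \<phi> = kron \<phi> d" "d \<in> carrier_mat r 1" "adj d * d = 1\<^sub>m 1"
    and "c \<noteq> d"
  shows "adj \<psi> * \<phi> = 0\<^sub>m 1 1"
proof (rule ccontr)
  assume ne: "adj \<psi> * \<phi> \<noteq> 0\<^sub>m 1 1"
  have one: "A = B" if "A \<in> carrier_mat 1 1" "B \<in> carrier_mat 1 1" "A $$ (0, 0) = B $$ (0, 0)"
    for A B :: "complex mat"
    by (rule eq_matI) (use that in auto)
  have "adj \<psi> * \<phi> = adj \<psi> * ((adj Z * Z) * \<phi>)" using Z(2) \<phi>(1) by (simp add: one_mult_dim)
  also have "\<dots> = adj (Z * \<psi>) * (Z * \<phi>)" using Z(1) \<psi>(1) \<phi>(1) by (simp add: adj_mult mult_assoc_dim)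
  also have "\<dots> = kron (adj \<psi> * \<phi>) (adj c * d)"
    unfolding \<psi>(2) \<phi>(2) adj_kron by (rule kron_mult) (use \<psi> \<phi> in auto)
  finally have "(adj \<psi> * \<phi>) $$ (0, 0) = kron (adj \<psi> * \<phi>) (adj c * d) $$ (0, 0)" by (rule arg_cong)
  also have "\<dots> = (adj \<psi> * \<phi>) $$ (0, 0) * (adj c * d) $$ (0, 0)"
    using \<psi> \<phi> by (simp del: index_mult_mat(1))
  finally have "(adj \<psi> * \<phi>) $$ (0, 0) = 0 \<or> (adj c * d) $$ (0, 0) = 1" by simp
  moreover have "(adj \<psi> * \<phi>) $$ (0, 0) \<noteq> 0" using ne one[of "adj \<psi> * \<phi>" "0\<^sub>m 1 1"] \<psi> \<phi> by auto
  ultimately have cd: "adj c * d = 1\<^sub>m 1" using one[of "adj c * d" "1\<^sub>m 1"] \<psi> \<phi> by auto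
  have "adj d * c = adj (adj c * d)" using \<psi> \<phi> by (simp add: adj_mult)
  then have dc: "adj d * c = 1\<^sub>m 1" using cd by simp
  \<comment> \<open>Two unit vectors with inner product 1 coincide: the squared norm of their
    difference is 1 - 1 - (1 - 1).\<close>
  have D: "c - d \<in> carrier_mat r 1" using \<psi> \<phi> by auto
  have "adj (c - d) * (c - d) = adj c * c - adj d * c - (adj c * d - adj d * d)"
    using \<psi>(3) \<phi>(3) by (simp add: adj_diff diff_mult_dim mult_diff_dim)
  also have "\<dots> = 0\<^sub>m 1 1" unfolding \<psi>(4) \<phi>(4) cd dc by simp
  finally have "mtrace ((c - d) * adj (c - d)) = 0"
    using D mtrace_comm[of "c - d" "adj (c - d)"] by (simp add: mtrace_def)
  then have 0: "c - d = 0\<^sub>m r 1" using mtrace_mult_adj_eq_0 D by (metis carrier_matD)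
  have "c = d"
  proof (rule eq_matI)
    fix i j assume "i < dim_row d" "j < dim_col d"
    then have "(c - d) $$ (i, j) = 0" "i < r" "j < 1" using \<phi>(3) by (auto simp: 0)
    then show "c $$ (i, j) = d $$ (i, j)" using \<psi>(3) \<phi>(3) by simp
  qed (use \<psi> \<phi> in auto)
  then show False using assms by simp
qed

text \<open>What one state reveals: its pure output \<psi> and environment vector \<open>c\<close>.
  Stated as a single predicate so that \<psi> and \<open>c\<close> can be chosen as functions of the
  state; the last conjunct depends on \<open>c\<close> only through its marginal.\<close>

definition splits_off ::
  "nat \<Rightarrow> nat \<Rightarrow> nat \<Rightarrow> complex mat \<Rightarrow> complex mat \<Rightarrow> complex mat \<Rightarrow> complex mat \<Rightarrow> complex mat \<Rightarrow> bool"
  where "splits_off m k l V Z \<rho> \<psi> c \<longleftrightarrow>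
    \<psi> \<in> carrier_mat m 1 \<and> adj \<psi> * \<psi> = 1\<^sub>m 1 \<and> c \<in> carrier_mat (k * l) 1 \<and> adj c * c = 1\<^sub>m 1 \<and>
    Z * \<psi> = kron \<psi> c \<and> V * \<rho> * adj V = kron (\<psi> * adj \<psi>) (ptrace k l (c * adj c))"

text \<open>\<open>V\<close> and \<open>Z\<close> are fixed before \<rho>: one pair of dilations
  serves all states, and only so can the environment vectors of different states be
  compared.\<close>

lemma reversible_purification_factors:
  assumes \<Lambda>: "cptp n m \<Lambda>" and \<Lambda>': "cptp m n \<Lambda>'"
  obtains k l V Z where "V \<in> carrier_mat (m * k) n" "adj V * V = 1\<^sub>m n"
    "Z \<in> carrier_mat (m * (k * l)) m" "adj Z * Z = 1\<^sub>m m"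
    "\<And>\<rho>. density n \<rho> \<Longrightarrow> mtrace (\<Lambda> \<rho> * \<Lambda> \<rho>) = 1 \<Longrightarrow> \<Lambda>' (\<Lambda> \<rho>) = \<rho> \<Longrightarrow>
      \<exists>\<psi> c. splits_off m k l V Z \<rho> \<psi> c"
proof -
  obtain k V where V: "V \<in> carrier_mat (m * k) n" "adj V * V = 1\<^sub>m n"
    "\<And>X. X \<in> carrier_mat n n \<Longrightarrow> \<Lambda> X = ptrace m k (V * X * adj V)"
    using cptp_Stinespring[OF \<Lambda>] by blast
  obtain l W where W: "W \<in> carrier_mat (n * l) m" "adj W * W = 1\<^sub>m m"
    "\<And>X. X \<in> carrier_mat m m \<Longrightarrow> \<Lambda>' X = ptrace n l (W * X * adj W)"
    using cptp_Stinespring[OF \<Lambda>'] by blast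
  let ?K = "kron V (1\<^sub>m l)"
  define Z where "Z = ?K * W"
  have K: "?K \<in> carrier_mat (m * k * l) (n * l)" using V(1) by simp
  have Z': "Z \<in> carrier_mat (m * k * l) m" unfolding Z_def using K W(1) by (rule mult_carrier_mat)
  then have Z: "Z \<in> carrier_mat (m * (k * l)) m" by (simp only: mult.assoc)
  have "adj ?K * ?K = 1\<^sub>m (n * l)"
    using V(1) by (simp add: adj_kron kron_mult V(2) one_mult_dim kron_one)
  then have "adj Z * Z = adj W * (1\<^sub>m (n * l) * W)"
    using V(1) W(1) by (simp add: Z_def adj_mult mult_assoc_dim flip: mult_assoc_dim[of "adj ?K" ?K W])
  then have ZZ: "adj Z * Z = 1\<^sub>m m" using W by (simp add: one_mult_dim)
  have "\<exists>\<psi> c. splits_off m k l V Z \<rho> \<psi> c"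
    if \<rho>: "density n \<rho>" and pure: "mtrace (\<Lambda> \<rho> * \<Lambda> \<rho>) = 1" and rev: "\<Lambda>' (\<Lambda> \<rho>) = \<rho>" for \<rho>
  proof -
    have \<rho>c: "\<rho> \<in> carrier_mat n n" and psd: "psd n \<rho>" using \<rho> psd_carrier by (auto simp: density_def)
    have "psd m (\<Lambda> \<rho>)" unfolding V(3)[OF \<rho>c] by (intro psd_ptrace psd_conj[OF psd V(1)])
    then have "density m (\<Lambda> \<rho>)" using \<rho> \<rho>c \<Lambda> by (simp add: density_def cptp_iff)
    then obtain \<psi> where \<psi>: "\<psi> \<in> carrier_mat m 1" "adj \<psi> * \<psi> = 1\<^sub>m 1" "\<Lambda> \<rho> = \<psi> * adj \<psi>"
      using pure_density pure by blast
    define z where "z = Z * \<psi>"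
    have z: "z \<in> carrier_mat (m * (k * l)) 1" using Z \<psi>(1) by (auto simp: z_def)
    have \<psi>\<psi>: "\<psi> * adj \<psi> \<in> carrier_mat m m" using \<psi>(1) by auto
    have "z * adj z = ?K * (W * (\<psi> * adj \<psi>) * adj W) * adj ?K"
      using V(1) W(1) \<psi>(1) by (simp add: z_def Z_def adj_mult mult_assoc_dim)
    then have "ptrace (m * k) l (z * adj z) = V * ptrace n l (W * (\<psi> * adj \<psi>) * adj W) * adj V"
      using W(1) \<psi>\<psi> by (simp only:) (intro ptrace_conj[OF V(1)], auto)
    also have "ptrace n l (W * (\<psi> * adj \<psi>) * adj W) = \<rho>"
      using W(3)[OF \<psi>\<psi>] \<psi>(3) rev by simp
    finally have pz: "ptrace (m * k) l (z * adj z) = V * \<rho> * adj V" .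
    \<comment> \<open>Tracing out the environment of \<open>V\<close> as well leaves the pure
      output, so \<open>z\<close> has a pure marginal and must be a product.\<close>
    then have "ptrace m (k * l) (z * adj z) = \<psi> * adj \<psi>"
      using V(3)[OF \<rho>c] \<psi>(3) by (simp flip: ptrace_ptrace)
    then obtain c where c: "c \<in> carrier_mat (k * l) 1" "z = kron \<psi> c"
      using ptrace_pure[OF z \<psi>(1,2)] by blast
    have "adj z * z = adj \<psi> * ((adj Z * Z) * \<psi>)"
      using Z \<psi>(1) by (simp add: z_def adj_mult mult_assoc_dim)
    also have "\<dots> = 1\<^sub>m 1" unfolding ZZ using \<psi> by (simp add: one_mult_dim)
    finally have "kron (adj \<psi> * \<psi>) (adj c * c) = 1\<^sub>m 1"
      unfolding c(2) adj_kron using c(1) \<psi>(1) by (subst kron_mult[symmetric]) auto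
    then have "adj c * c = 1\<^sub>m 1" unfolding \<psi>(2) kron_one_left .
    moreover have "V * \<rho> * adj V = kron (\<psi> * adj \<psi>) (ptrace k l (c * adj c))"
    proof -
      have "z * adj z = kron (\<psi> * adj \<psi>) (c * adj c)"
        unfolding c(2) adj_kron by (rule kron_mult) (use c(1) \<psi>(1) in auto)
      moreover have "c * adj c \<in> carrier_mat (k * l) (k * l)" using c(1) by auto
      ultimately show ?thesis using pz ptrace_kron_right[OF \<psi>\<psi>] by simp
    qed
    ultimately show ?thesis using \<psi> c by (auto simp: z_def splits_off_def)
  qed
  then show ?thesis using that V(1,2) Z ZZ by blast
qed

lemma purifiable_decomposition:
  assumes M: "\<And>\<rho>. \<rho> \<in> M \<Longrightarrow> density n \<rho>" and "purifiable n M"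
  obtains I :: "nat set" and Ms where "M = (\<Union>i\<in>I. Ms i)"
    "\<And>i j. i \<in> I \<Longrightarrow> j \<in> I \<Longrightarrow> i \<noteq> j \<Longrightarrow> orth_sets (Ms i) (Ms j)"
    "\<And>i. i \<in> I \<Longrightarrow> essentially_pure n (Ms i)"
proof -
  obtain m \<Lambda> \<Lambda>' where \<Lambda>: "cptp n m \<Lambda>" "cptp m n \<Lambda>'"
    "\<And>\<rho>. \<rho> \<in> M \<Longrightarrow> mtrace (\<Lambda> \<rho> * \<Lambda> \<rho>) = 1" "\<And>\<rho>. \<rho> \<in> M \<Longrightarrow> \<Lambda>' (\<Lambda> \<rho>) = \<rho>"
    using assms(2) unfolding purifiable_def by blast
  obtain k l V Z where V: "V \<in> carrier_mat (m * k) n" "adj V * V = 1\<^sub>m n"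
    and Z: "Z \<in> carrier_mat (m * (k * l)) m" "adj Z * Z = 1\<^sub>m m"
    and "\<And>\<rho>. density n \<rho> \<Longrightarrow> mtrace (\<Lambda> \<rho> * \<Lambda> \<rho>) = 1 \<Longrightarrow> \<Lambda>' (\<Lambda> \<rho>) = \<rho> \<Longrightarrow>
      \<exists>\<psi> c. splits_off m k l V Z \<rho> \<psi> c"
    using reversible_purification_factors[OF \<Lambda>(1,2)] by metis
  then have "\<forall>\<rho>\<in>M. \<exists>\<psi> c. splits_off m k l V Z \<rho> \<psi> c"
    using M \<Lambda>(3,4) by blast
  then obtain \<psi> c where "\<forall>\<rho>\<in>M. splits_off m k l V Z \<rho> (\<psi> \<rho>) (c \<rho>)" by metis
  note \<psi>c = this[unfolded splits_off_def]
  have orth: "adj (\<psi> \<rho>) * \<psi> \<sigma> = 0\<^sub>m 1 1" if "\<rho> \<in> M" "\<sigma> \<in> M" "c \<rho> \<noteq> c \<sigma>" for \<rho> \<sigma>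
    by (rule environment_orth[OF Z]) (use \<psi>c that in auto)
  \<comment> \<open>One representative state for each environment vector. Their outputs are
    orthonormal in C^m, so only finitely many environment vectors occur and \<open>f\<close> can
    number them.\<close>
  define r where "r e = (SOME \<rho>. \<rho> \<in> M \<and> c \<rho> = e)" for e
  have r: "r e \<in> M" "c (r e) = e" if "e \<in> c ` M" for e
    using someI_ex[of "\<lambda>\<rho>. \<rho> \<in> M \<and> c \<rho> = e"] that by (auto simp: r_def)
  have r_orth: "adj (\<psi> (r e)) * \<psi> (r e') = 0\<^sub>m 1 1" if "e \<in> c ` M" "e' \<in> c ` M" "e \<noteq> e'" for e e'
    using orth r that by metis
  have "finite ((\<lambda>e. \<psi> (r e)) ` (c ` M))"
  proof (rule orthonormal_finite[of _ m])
    fix u v assume "u \<in> (\<lambda>e. \<psi> (r e)) ` c ` M" "v \<in> (\<lambda>e. \<psi> (r e)) ` c ` M" "u \<noteq> v"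
    then obtain e e' where e: "e \<in> c ` M" "e' \<in> c ` M" "u = \<psi> (r e)" "v = \<psi> (r e')" by blast
    then have "e \<noteq> e'" using \<open>u \<noteq> v\<close> by auto
    then show "adj u * v = 0\<^sub>m 1 1" using r_orth e by simp
  qed (use \<psi>c r in auto)
  moreover have "inj_on (\<lambda>e. \<psi> (r e)) (c ` M)"
  proof (rule inj_onI, rule ccontr)
    fix e e' assume e: "e \<in> c ` M" "e' \<in> c ` M" "\<psi> (r e) = \<psi> (r e')" "e \<noteq> e'"
    then have "adj (\<psi> (r e)) * \<psi> (r e) = 0\<^sub>m 1 1" using r_orth[of e e'] by simp
    then show False using \<psi>c r(1)[OF e(1)] one_mat_1_neq_zero by simp
  qed
  ultimately have "finite (c ` M)" by (rule finite_imageD)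
  then obtain f :: "complex mat \<Rightarrow> nat" where f: "inj_on f (c ` M)"
    using finite_imp_inj_to_nat_seg by blast
  define Ms where "Ms i = {\<rho> \<in> M. f (c \<rho>) = i}" for i
  define I where "I = (\<lambda>\<rho>. f (c \<rho>)) ` M"
  show ?thesis
  proof (rule that[where I = I and Ms = Ms])
    show "M = (\<Union>i\<in>I. Ms i)" by (auto simp: I_def Ms_def)
  next
    fix i j assume ij: "i \<in> I" "j \<in> I" "i \<noteq> j"
    have "mtrace (\<rho> * \<sigma>) = 0" if \<rho>: "\<rho> \<in> Ms i" and \<sigma>: "\<sigma> \<in> Ms j" for \<rho> \<sigma>
    proof -
      have in_M: "\<rho> \<in> M" "\<sigma> \<in> M" "c \<rho> \<noteq> c \<sigma>" using \<rho> \<sigma> ij by (auto simp: Ms_def)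
      have c: "\<rho> \<in> carrier_mat n n" "\<sigma> \<in> carrier_mat n n"
        using M in_M psd_carrier by (auto simp: density_def)
      have \<psi>: "\<psi> \<rho> \<in> carrier_mat m 1" "\<psi> \<sigma> \<in> carrier_mat m 1" using \<psi>c in_M by auto
      \<comment> \<open>Orthogonality is carried back from the outputs to the states: conjugation by
        the isometry \<open>V\<close> preserves traces and products, and the first tensor factor of
        the product contains the inner product of the two outputs.\<close>
      have "mtrace (\<rho> * \<sigma>) = mtrace (V * (\<rho> * \<sigma>) * adj V)"
        using mtrace_conj[OF V] c by simp
      also have "V * (\<rho> * \<sigma>) * adj V = V * \<rho> * ((adj V * V) * \<sigma>) * adj V"
        unfolding V(2) using c V(1) by (simp add: one_mult_dim mult_assoc_dim)
      also have "\<dots> = (V * \<rho> * adj V) * (V * \<sigma> * adj V)"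
        using c V(1) by (simp add: mult_assoc_dim)
      also have "\<dots> = kron ((\<psi> \<rho> * adj (\<psi> \<rho>)) * (\<psi> \<sigma> * adj (\<psi> \<sigma>)))
          (ptrace k l (c \<rho> * adj (c \<rho>)) * ptrace k l (c \<sigma> * adj (c \<sigma>)))"
        using \<psi>c in_M carrier_matD[OF \<psi>(1)] carrier_matD[OF \<psi>(2)] by (simp add: kron_mult)
      also have "(\<psi> \<rho> * adj (\<psi> \<rho>)) * (\<psi> \<sigma> * adj (\<psi> \<sigma>)) = \<psi> \<rho> * ((adj (\<psi> \<rho>) * \<psi> \<sigma>) * adj (\<psi> \<sigma>))"
        using \<psi> by (simp add: mult_assoc_dim)
      also have "\<dots> = 0\<^sub>m m m" unfolding orth[OF in_M] using \<psi> by simp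
      finally show ?thesis by (simp add: kron_zero_left mtrace_def)
    qed
    then show "orth_sets (Ms i) (Ms j)" by (simp add: orth_sets_def)
  next
    fix i assume "i \<in> I"
    then obtain \<rho>0 where \<rho>0: "\<rho>0 \<in> M" "i = f (c \<rho>0)" by (auto simp: I_def)
    \<comment> \<open>As \<open>f\<close> is injective, a part has a single environment vector,
      hence one state \<open>?\<eta>\<close> that works for all its members.\<close>
    have same: "\<rho> \<in> M \<and> c \<rho> = c \<rho>0" if "\<rho> \<in> Ms i" for \<rho>
      using that \<rho>0 f by (auto simp: Ms_def inj_on_def)
    have c0: "c \<rho>0 \<in> carrier_mat (k * l) 1" "adj (c \<rho>0) * c \<rho>0 = 1\<^sub>m 1" using \<psi>c \<rho>0 by auto
    let ?\<eta> = "ptrace k l (c \<rho>0 * adj (c \<rho>0))"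
    have "mtrace ?\<eta> = mtrace (adj (c \<rho>0) * c \<rho>0)"
      using c0(1) by (subst mtrace_ptrace, force) (rule mtrace_comm, auto)
    then have "density k ?\<eta>"
      using psd_ptrace[OF psd_mult_adj[OF c0(1)]] by (simp add: density_def c0(2) mtrace_def)
    then show "essentially_pure n (Ms i)"
    proof (rule essentially_pureI[OF V, rotated 2])
      show "Ms i \<noteq> {}" using \<rho>0 by (auto simp: Ms_def)
      show "density n \<rho>" if "\<rho> \<in> Ms i" for \<rho> using M same[OF that] by blast
      show "\<exists>\<psi> \<in> carrier_mat m 1. adj \<psi> * \<psi> = 1\<^sub>m 1 \<and> V * \<rho> * adj V = kron (\<psi> * adj \<psi>) ?\<eta>"
        if "\<rho> \<in> Ms i" for \<rho>
        using \<psi>c same[OF that] by metis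
    qed
  qed
qed

theorem theorem1:
  fixes d_in :: nat and M :: "complex mat set"
  assumes "\<forall>\<rho> \<in> M. density d_in \<rho>"
  shows "(\<exists>d_out \<Lambda>. cptp d_in d_out \<Lambda> \<and>
            (\<forall>\<rho> \<in> M. mtrace (\<Lambda> \<rho> * \<Lambda> \<rho>) = 1) \<and>
            (\<exists>\<Lambda>'. cptp d_out d_in \<Lambda>' \<and> (\<forall>\<rho> \<in> M. \<Lambda>' (\<Lambda> \<rho>) = \<rho>)))
     \<longleftrightarrow>
         (\<exists>(I :: nat set) Ms. M = (\<Union>i\<in>I. Ms i) \<and>
            (\<forall>i\<in>I. \<forall>j\<in>I. i \<noteq> j \<longrightarrow> orth_sets (Ms i) (Ms j)) \<and>
            (\<forall>i\<in>I. essentially_pure d_in (Ms i)))"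
    (is "?L \<longleftrightarrow> ?R")
proof
  assume ?L
  then have "purifiable d_in M" unfolding purifiable_def .
  then obtain I :: "nat set" and Ms where "M = (\<Union>i\<in>I. Ms i)"
    "\<And>i j. i \<in> I \<Longrightarrow> j \<in> I \<Longrightarrow> i \<noteq> j \<Longrightarrow> orth_sets (Ms i) (Ms j)"
    "\<And>i. i \<in> I \<Longrightarrow> essentially_pure d_in (Ms i)"
    using purifiable_decomposition[of M d_in] assms by metis
  then show ?R by (intro exI[of _ I] exI[of _ Ms]) auto
next
  assume ?R
  then obtain I :: "nat set" and Ms where M: "M = (\<Union>i\<in>I. Ms i)"
    and orth: "\<forall>i\<in>I. \<forall>j\<in>I. i \<noteq> j \<longrightarrow> orth_sets (Ms i) (Ms j)"
    and ep: "\<forall>i\<in>I. essentially_pure d_in (Ms i)" by blast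
  have "purifiable d_in M" by (rule purifiable_Union[OF M]) (use assms orth ep in auto)
  then show ?L unfolding purifiable_def .
qed

end
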